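(* Let $\alpha,b,x_1,\dots,x_n,a_1,\dots,a_n$ be complex parameters such that no denominator in the identity below vanishes. Let $f(y_1,\dots,y_n)$ be a complex function of $n$ variables (defined at all points where it is evaluated below). Assume that either (i) $f$ is such that both sides of the identity are analytic in $a_1,\dots,a_n$ and the series converges absolutely for each $a_r$ in a disk around the origin, and each $a_r$ lies in this disk; or (ii) $a_r=q^{N_r}$ with $N_r$ a positive integer for $r=1,\dots,n$ (so that the series terminates). Then $$\begin{aligned} & f(\alpha a_{1},\dots,\alpha a_{n})\prod_{r=1}^{n}\frac{(\alpha qx_{r},\alpha a_{r}bx_{r}/q)_{\infty}}{(\alpha bx_{r},\alpha x_{r}a_{r})_{\infty}}\\ &=\sum_{k_1,\dots,k_n\ge0}\ \prod_{1\leq r<s\leq n}\frac{1-q^{k_{r}-k_{s}}x_{r}/x_{s}}{1-x_{r}/x_{s}}\prod_{r,s=1}^{n}\frac{(qx_{r}/(x_{s}a_{s}))_{k_{r}}}{(qx_{r}/x_{s})_{k_{r}}}\\ &\quad\times\prod_{r=1}^{n}\frac{1-\alpha x_{r}q^{k_{r}+|\boldsymbol{k}|}}{1-\alpha x_{r}}\prod_{r=1}^{n}\frac{(\alpha x_{r})_{|\boldsymbol{k}|}}{(\alpha x_{r}a_{r})_{|\boldsymbol{k}|}}(a_{1}\cdots a_{n}/q^{n})^{|\boldsymbol{k}|}q^{\sum_{r=1}^{n}(r-1)k_{r}}\\ &\quad\times\sum_{\substack{0\leq m_{r}\leq k_{r}\\ r=1,\dots,n}}\ \prod_{1\leq r<s\leq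 n}\frac{1-q^{m_{r}-m_{s}}x_{r}/x_{s}}{1-x_{r}/x_{s}}\prod_{r,s=1}^{n}\frac{(q^{-k_{s}}x_{r}/x_{s})_{m_{r}}}{(qx_{r}/x_{s})_{m_{r}}}\prod_{r=1}^{n}\frac{(\alpha x_{r}q^{|\boldsymbol{k}|})_{m_{r}}}{(\alpha bx_{r})_{m_{r}}}\,q^{\sum_{r=1}^{n}rm_{r}}f(\alpha q^{1+m_{1}},\dots,\alpha q^{1+m_{n}}). \end{aligned}$$
   Context: $q$ is a complex number with $0<|q|<1$ and $n\ge1$ is an integer. $(z)_\infty=\prod_{i\ge0}(1-zq^i)$ and $(z)_k=(z)_\infty/(zq^k)_\infty=\prod_{i=0}^{k-1}(1-zq^i)$; $(c_1,\dots,c_p)_k=(c_1)_k\cdots(c_p)_k$ for $k$ a nonnegative integer or $\infty$. Bold letters denote multi-indices of nonnegative integers, $\boldsymbol k=(k_1,\dots,k_n)$, with $|\boldsymbol k|=k_1+\cdots+k_n$. If some $a_s=0$, the expression $\prod_{r,s}(qx_r/(x_sa_s))_{k_r}(a_1\cdots a_n)^{|\boldsymbol k|}$, which is polynomial in the $a_s$, is understood by continuity. *)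

theory Defs
  imports "HOL-Complex_Analysis.Complex_Analysis"
begin

definition qpoch_inf :: "complex \<Rightarrow> complex \<Rightarrow> complex" where
  "qpoch_inf q z = (\<Prod>i. 1 - z * q ^ i)"

definition qpoch :: "complex \<Rightarrow> complex \<Rightarrow> nat \<Rightarrow> complex" where
  "qpoch q z k = (\<Prod>i<k. 1 - z * q ^ i)"

(* An n-tuple is a function on {1..n}.  Multi-indices and the arguments of f are normalised to
   the value undefined outside {1..n}, so that distinct functions are distinct tuples. *)

definition multi_indices :: "nat \<Rightarrow> (nat \<Rightarrow> nat) set" where
  "multi_indices n = ({1..n} \<rightarrow>\<^sub>E UNIV)"

definition msize :: "nat \<Rightarrow> (nat \<Rightarrow> nat) \<Rightarrow> nat" where
  "msize n k = (\<Sum>r=1..n. k r)"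

definition polydisc :: "nat \<Rightarrow> (nat \<Rightarrow> real) \<Rightarrow> (nat \<Rightarrow> complex) set" where
  "polydisc n R = {a. \<forall>r\<in>{1..n}. norm (a r) < R r}"

(* Analyticity of a function of the n variables c 1, ..., c n: near each point it is the sum of a
   convergent power series in n variables. *)
definition mv_analytic_on :: "nat \<Rightarrow> ((nat \<Rightarrow> complex) \<Rightarrow> complex) \<Rightarrow> (nat \<Rightarrow> complex) set \<Rightarrow> bool" where
  "mv_analytic_on n F U \<longleftrightarrow>
     (\<forall>c\<in>U. \<exists>\<rho>>0. \<exists>C. \<forall>z. (\<forall>r\<in>{1..n}. norm (z r - c r) < \<rho>) \<longrightarrow>
        ((\<lambda>k. C k * (\<Prod>r=1..n. (z r - c r) ^ k r)) has_sum F z) (multi_indices n))"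

definition vandermonde_ratio :: "nat \<Rightarrow> complex \<Rightarrow> (nat \<Rightarrow> complex) \<Rightarrow> (nat \<Rightarrow> nat) \<Rightarrow> complex" where
  "vandermonde_ratio n q x k =
     (\<Prod>r=1..n. \<Prod>s=r+1..n.
        (1 - q powi (int (k r) - int (k s)) * x r / x s) / (1 - x r / x s))"

(* The product of all (q x_r / (x_s a_s))_{k_r}, times (a_1 ... a_n)^|k|, written as the polynomial
   in the a_s that it is; this includes the value by continuity when some a_s = 0.  See the two
   lemmas below. *)
definition shifted_numerator ::
  "nat \<Rightarrow> complex \<Rightarrow> (nat \<Rightarrow> complex) \<Rightarrow> (nat \<Rightarrow> complex) \<Rightarrow> (nat \<Rightarrow> nat) \<Rightarrow> complex" where
  "shifted_numerator n q x a k =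
     (\<Prod>r=1..n. \<Prod>s=1..n. \<Prod>i<k r. a s - q * x r / x s * q ^ i)"

lemma shifted_numerator_eq:
  assumes "\<And>s. s \<in> {1..n} \<Longrightarrow> a s \<noteq> 0"
  shows "shifted_numerator n q x a k =
     (\<Prod>r=1..n. \<Prod>s=1..n. qpoch q (q * x r / (x s * a s)) (k r)) * (\<Prod>s=1..n. a s) ^ msize n k"
proof -
  have factor: "(\<Prod>i<m. a s - q * x r / x s * q ^ i) = qpoch q (q * x r / (x s * a s)) m * a s ^ m"
    if "s \<in> {1..n}" for r s m
  proof -
    have "(\<Prod>i<m. a s - q * x r / x s * q ^ i)
        = (\<Prod>i<m. (1 - q * x r / (x s * a s) * q ^ i) * a s)"
      using assms[OF that] by (intro prod.cong) (auto simp: divide_simps algebra_simps)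
    then show ?thesis
      by (simp add: qpoch_def prod.distrib)
  qed
  have "shifted_numerator n q x a k =
      (\<Prod>r=1..n. \<Prod>s=1..n. qpoch q (q * x r / (x s * a s)) (k r) * a s ^ k r)"
    unfolding shifted_numerator_def by (intro prod.cong refl factor)
  also have "\<dots> = (\<Prod>r=1..n. \<Prod>s=1..n. qpoch q (q * x r / (x s * a s)) (k r)) *
      (\<Prod>r=1..n. (\<Prod>s=1..n. a s) ^ k r)"
    by (simp add: prod.distrib prod_power_distrib)
  finally show ?thesis
    by (simp add: msize_def power_sum)
qed

lemma continuous_shifted_numerator:
  "continuous_on UNIV (\<lambda>a. shifted_numerator n q x a k)"
  unfolding shifted_numerator_def
  by (intro continuous_intros continuous_on_product_coordinates)

definition identity_lhs where
  "identity_lhs n q \<alpha> b x f a =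
     f (\<lambda>r\<in>{1..n}. \<alpha> * a r) *
     (\<Prod>r=1..n. (qpoch_inf q (\<alpha> * q * x r) * qpoch_inf q (\<alpha> * a r * b * x r / q)) /
               (qpoch_inf q (\<alpha> * b * x r) * qpoch_inf q (\<alpha> * x r * a r)))"
  for n :: nat and q \<alpha> b :: complex and x a :: "nat \<Rightarrow> complex"
    and f :: "(nat \<Rightarrow> complex) \<Rightarrow> complex"

definition inner_sum where
  "inner_sum n q \<alpha> b x f k =
     (\<Sum>m \<in> (\<Pi>\<^sub>E r\<in>{1..n}. {0..k r}).
        vandermonde_ratio n q x m *
        (\<Prod>r=1..n. \<Prod>s=1..n.
           qpoch q (q powi (- int (k s)) * x r / x s) (m r) / qpoch q (q * x r / x s) (m r)) *
        (\<Prod>r=1..n. qpoch q (\<alpha> * x r * q ^ msize n k) (m r) / qpoch q (\<alpha> * b * x r) (m r)) *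
        q ^ (\<Sum>r=1..n. r * m r) *
        f (\<lambda>r\<in>{1..n}. \<alpha> * q ^ (1 + m r)))"
  for n :: nat and q \<alpha> b :: complex and x :: "nat \<Rightarrow> complex"
    and f :: "(nat \<Rightarrow> complex) \<Rightarrow> complex" and k :: "nat \<Rightarrow> nat"

definition identity_term where
  "identity_term n q \<alpha> b x f a k =
     vandermonde_ratio n q x k *
     (shifted_numerator n q x a k / (\<Prod>r=1..n. \<Prod>s=1..n. qpoch q (q * x r / x s) (k r))) *
     (\<Prod>r=1..n. (1 - \<alpha> * x r * q ^ (k r + msize n k)) / (1 - \<alpha> * x r)) *
     (\<Prod>r=1..n. qpoch q (\<alpha> * x r) (msize n k) / qpoch q (\<alpha> * x r * a r) (msize n k)) *
     (1 / q ^ n) ^ msize n k *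
     q ^ (\<Sum>r=1..n. (r - 1) * k r) *
     inner_sum n q \<alpha> b x f k"
  for n :: nat and q \<alpha> b :: complex and x a :: "nat \<Rightarrow> complex"
    and f :: "(nat \<Rightarrow> complex) \<Rightarrow> complex" and k :: "nat \<Rightarrow> nat"

(* No condition a_s \<noteq> 0: the zeros of the a_s are removed by shifted_numerator. *)
definition denominators_nonzero where
  "denominators_nonzero n q \<alpha> b x a \<longleftrightarrow>
     (\<forall>r\<in>{1..n}. x r \<noteq> 0 \<and> 1 - \<alpha> * x r \<noteq> 0 \<and>
        qpoch_inf q (\<alpha> * b * x r) \<noteq> 0 \<and> qpoch_inf q (\<alpha> * x r * a r) \<noteq> 0 \<and>
        (\<forall>k. qpoch q (\<alpha> * b * x r) k \<noteq> 0 \<and> qpoch q (\<alpha> * x r * a r) k \<noteq> 0) \<and>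
        (\<forall>s\<in>{1..n}. (r < s \<longrightarrow> 1 - x r / x s \<noteq> 0) \<and> (\<forall>k. qpoch q (q * x r / x s) k \<noteq> 0)))"
  for n :: nat and q \<alpha> b :: complex and x a :: "nat \<Rightarrow> complex"

end

(* For a_r = q^(M_r + 1) the series terminates, and because f is arbitrary the identity says that
   two triangular matrices indexed by multi-indices, the outer coefficients T(M, k) and the inner
   coefficients K(k, m), have the product T K = diag P with P(M) = prod_r (alpha q x_r)_{M_r}.
   For generic alpha one may check the reverse product K (P^{-1} T) = 1 instead.  There, with
   v_r = x_r q^{k_r} and W(z) = prod_{s, i <= M_s} (z - x_s q^i), the k-th term of the (M, m) entry is a
   constant times prod_{r<s} (v_s - v_r) * prod_r g(v_r) / W'(v_r) with deg g < |M|.  Let v_1 run over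
   all the zeros of W: by Lagrange interpolation the sum is 0, and the contribution of the t-th
   block, t <> 1, vanishes by antisymmetry in v_1 and v_t; so the original sum vanishes as well.
   Special alpha follow by continuity, and the analytic case by the identity theorem in one
   variable at a time, since the points q^N accumulate at 0. *)
theory Submission
  imports Defs
begin

section \<open>Lagrange interpolation and Vandermonde sums\<close>

text \<open>The obstacle in summing T K directly is that |k| occurs in (alpha x_r)_{|k|}, (alpha x_r
  a_r)_{|k|} and (alpha x_r q^{|k|})_{m_r}, which couples all coordinates of the summation index. In
  the reverse product |k| survives only in q^{|k||m|}, and this power is exactly what turns the
  remaining shifted factorials of T into values of one polynomial at v_1, ..., v_n. Apart from the
  Vandermonde factor, everything is then a product of functions of single coordinates. The bound deg
  g < |M| leaves no slack: W has |M| + n zeros, interpolation annihilates degrees up to |M| + n - 2,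
  and the Vandermonde product takes up n - 1 of these in each variable. The parameter b stays
  outside the matrices: 1/(alpha b x_r)_{m_r} is independent of k and travels with the value of f.
  Passing from one product to the other is a statement about finite square matrices, so all indices
  are confined to one box, and triangularity makes the truncation exact.\<close>

lemma qpoch_0 [simp]: "qpoch q z 0 = 1"
  by (simp add: qpoch_def)

lemma qpoch_Suc: "qpoch q z (Suc k) = qpoch q z k * (1 - z * q ^ k)"
  by (simp add: qpoch_def)

lemma qpoch_add: "qpoch q z (i + j) = qpoch q z i * qpoch q (z * q ^ i) j"
  by (induction j) (simp_all add: qpoch_Suc power_add mult.assoc)

text \<open>The sum is the coefficient of degree \<open>card Z - 1\<close> in the Lagrange
  interpolant of \<open>g\<close> at the points \<open>v p\<close>. The interpolant is
  \<open>g\<close> itself, whose degree is smaller.\<close>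

lemma sum_poly_div_prod_diff_eq_0:
  fixes v :: "'p \<Rightarrow> 'a::field"
  assumes "finite Z" "inj_on v Z" "degree g + 1 < card Z"
  shows "(\<Sum>p\<in>Z. poly g (v p) / (\<Prod>p'\<in>Z-{p}. v p - v p')) = 0"
proof -
  define W where "W p = (\<Prod>p'\<in>Z-{p}. v p - v p')" for p
  define l where "l p = (\<Prod>p'\<in>Z-{p}. [:- v p', 1:])" for p
  define h where "h = (\<Sum>p\<in>Z. smult (poly g (v p) / W p) (l p))"
  have W0: "W p \<noteq> 0" if "p \<in> Z" for p
    using assms that by (auto simp: W_def inj_on_def)
  have degl: "degree (l p) = card Z - 1" if "p \<in> Z" for p
    using assms(1) that by (simp add: l_def degree_prod_eq_sum_degree)
  have coeffl: "coeff (l p) (card Z - 1) = 1" if "p \<in> Z" for p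
  proof -
    have "lead_coeff (l p) = 1"
      unfolding l_def by (simp add: lead_coeff_prod)
    then show ?thesis using degl[OF that] by simp
  qed
  have ev: "poly (l p) (v p') = (if p' = p then W p else 0)" if "p \<in> Z" "p' \<in> Z" for p p'
    using that assms(1) by (auto simp: l_def W_def poly_prod)
  have "poly h (v p') = poly g (v p')" if "p' \<in> Z" for p'
  proof -
    have "poly h (v p') = (\<Sum>p\<in>Z. if p' = p then poly g (v p) else 0)"
      unfolding h_def poly_sum
      by (intro sum.cong refl) (use that W0 in \<open>auto simp: ev\<close>)
    then show ?thesis using that assms(1) by simp
  qed
  moreover have "degree h \<le> card Z - 1"
    unfolding h_def by (intro degree_sum_le assms(1)) (metis degree_smult_le degl)
  ultimately have "h = g"
    using assms
    by (intro poly_eqI_degree[of "v ` Z"]) (auto simp: card_image)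
  then have "coeff h (card Z - 1) = 0"
    using assms(3) by (simp add: coeff_eq_0)
  moreover have "coeff h (card Z - 1) = (\<Sum>p\<in>Z. poly g (v p) / W p)"
    unfolding h_def coeff_sum by (intro sum.cong refl) (simp only: coeff_smult coeffl mult_1_right)
  ultimately show ?thesis by (simp add: W_def)
qed

text \<open>The index set is arbitrary rather than an interval because one index, and then a second
  one, gets removed from the middle.\<close>

definition vdm :: "'i::linorder set \<Rightarrow> ('i \<Rightarrow> 'a::comm_ring_1) \<Rightarrow> 'a" where
  "vdm I X = (\<Prod>r\<in>I. \<Prod>s\<in>{s\<in>I. r < s}. X s - X r)"

text \<open>The constant is the sign \<open>(-1) ^ card {r\<in>I. r < t}\<close>. What matters is
  only that the same constant serves every \<open>X\<close>.\<close>

lemma vdm_remove: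
  assumes "finite I" "t \<in> I"
  obtains \<epsilon> :: "'a::comm_ring_1" where
    "\<And>X. vdm I X = \<epsilon> * (\<Prod>s\<in>I-{t}. X s - X t) * vdm (I - {t}) X"
proof
  fix X :: "'b \<Rightarrow> 'a"
  let ?J = "I - {t}"
  have "vdm I X = (\<Prod>s\<in>{s\<in>I. t < s}. X s - X t) * (\<Prod>r\<in>?J. \<Prod>s\<in>{s\<in>I. r < s}. X s - X r)"
    unfolding vdm_def using assms by (simp add: prod.remove)
  also have "(\<Prod>r\<in>?J. \<Prod>s\<in>{s\<in>I. r < s}. X s - X r) =
      (\<Prod>r\<in>?J. (if r < t then X t - X r else 1) * (\<Prod>s\<in>{s\<in>?J. r < s}. X s - X r))"
  proof (intro prod.cong refl)
    fix r assume "r \<in> ?J"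
    have "{s\<in>I. r < s} = (if r < t then insert t {s\<in>?J. r < s} else {s\<in>?J. r < s})"
      using assms by auto
    then show "(\<Prod>s\<in>{s\<in>I. r < s}. X s - X r) =
        (if r < t then X t - X r else 1) * (\<Prod>s\<in>{s\<in>?J. r < s}. X s - X r)"
      using assms by simp
  qed
  also have "\<dots> = (\<Prod>r\<in>?J. if r < t then X t - X r else 1) * vdm ?J X"
    by (simp add: prod.distrib vdm_def)
  also have "(\<Prod>r\<in>?J. if r < t then X t - X r else 1) = (\<Prod>r\<in>{r\<in>I. r < t}. X t - X r)"
    using assms by (subst prod.If_cases) (auto intro!: prod.cong)
  also have "\<dots> = (\<Prod>r\<in>{r\<in>I. r < t}. (-1) * (X r - X t))"
    by (intro prod.cong) auto
  also have "\<dots> = (-1) ^ card {r\<in>I. r < t} * (\<Prod>r\<in>{r\<in>I. r < t}. X r - X t)"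
    by (subst prod.distrib) simp
  also have "(\<Prod>s\<in>{s\<in>I. t < s}. X s - X t) * 
      ((-1) ^ card {r\<in>I. r < t} * (\<Prod>r\<in>{r\<in>I. r < t}. X r - X t) * vdm ?J X) =
    (-1) ^ card {r\<in>I. r < t} * ((\<Prod>s\<in>{s\<in>I. t < s}. X s - X t) * (\<Prod>r\<in>{r\<in>I. r < t}. X r - X t)) * vdm ?J X"
    by (simp add: algebra_simps)
  also have "(\<Prod>s\<in>{s\<in>I. t < s}. X s - X t) * (\<Prod>r\<in>{r\<in>I. r < t}. X r - X t) = (\<Prod>s\<in>?J. X s - X t)"
    using assms by (subst prod.union_disjoint[symmetric]) (auto intro!: prod.cong)
  finally show "vdm I X = (-1) ^ card {r\<in>I. r < t} * (\<Prod>s\<in>?J. X s - X t) * vdm ?J X"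
    by (simp add: mult.assoc)
qed

lemma vdm_cong: "(\<And>r. r \<in> I \<Longrightarrow> X r = Y r) \<Longrightarrow> vdm I X = vdm I Y"
  by (auto simp: vdm_def intro!: prod.cong)

text \<open>Once \<open>t\<close> and \<open>u\<close> are both split off, the other factors are
  symmetric in these two indices or avoid them; only the factor \<open>X u - X t\<close> changes
  sign.\<close>

lemma vdm_swap:
  fixes X :: "'i::linorder \<Rightarrow> 'a::comm_ring_1"
  assumes "finite I" "t \<in> I" "u \<in> I" "t \<noteq> u"
  shows "vdm I (X \<circ> Transposition.transpose t u) = - vdm I X"
proof -
  obtain \<epsilon> where \<epsilon>: "\<And>X::'i \<Rightarrow> 'a. vdm I X = \<epsilon> * (\<Prod>s\<in>I-{t}. X s - X t) * vdm (I - {t}) X"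
    using vdm_remove assms(1,2) by blast
  obtain \<delta> where \<delta>: "\<And>X::'i \<Rightarrow> 'a. vdm (I-{t}) X =
      \<delta> * (\<Prod>s\<in>I-{t}-{u}. X s - X u) * vdm (I - {t} - {u}) X"
    using vdm_remove[of "I-{t}" u] assms by blast
  let ?J = "I - {t} - {u}"
  have eq: "vdm I X = \<epsilon> * \<delta> * (X u - X t) * ((\<Prod>s\<in>?J. X s - X t) * (\<Prod>s\<in>?J. X s - X u)) * vdm ?J X"
    for X :: "'i \<Rightarrow> 'a"
    using assms unfolding \<epsilon>[of X] \<delta>[of X]
    by (subst prod.remove[of "I-{t}" u]) (auto simp: algebra_simps)
  have "vdm ?J (X \<circ> Transposition.transpose t u) = vdm ?J X"
    by (intro vdm_cong) (auto simp: Transposition.transpose_def)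
  moreover have "(\<Prod>s\<in>?J. (X \<circ> Transposition.transpose t u) s - c) = (\<Prod>s\<in>?J. X s - c)" for c
    by (intro prod.cong) (auto simp: Transposition.transpose_def)
  ultimately show ?thesis
    unfolding eq[of X] eq[of "X \<circ> Transposition.transpose t u"] by (simp add: algebra_simps)
qed

lemma sum_PiE_remove:
  assumes "t \<in> I"
  shows "(\<Sum>X\<in>Pi\<^sub>E I G. \<phi> X) = (\<Sum>Y\<in>Pi\<^sub>E (I - {t}) G. \<Sum>p\<in>G t. \<phi> (Y(t := p)))"
proof -
  have "Pi\<^sub>E I G = (\<lambda>(p, Y). Y(t := p)) ` (G t \<times> Pi\<^sub>E (I - {t}) G)"
    using PiE_insert_eq[of t "I - {t}" G] assms by (simp add: insert_absorb)
  moreover have "inj_on (\<lambda>(p, Y). Y(t := p)) (G t \<times> Pi\<^sub>E (I - {t}) G)"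
    by (rule inj_combinator) simp
  ultimately have "(\<Sum>X\<in>Pi\<^sub>E I G. \<phi> X) = (\<Sum>(p, Y)\<in>G t \<times> Pi\<^sub>E (I - {t}) G. \<phi> (Y(t := p)))"
    by (simp add: sum.reindex case_prod_unfold)
  also have "\<dots> = (\<Sum>p\<in>G t. \<Sum>Y\<in>Pi\<^sub>E (I - {t}) G. \<phi> (Y(t := p)))"
    by (simp add: sum.cartesian_product)
  finally show ?thesis
    by (subst sum.swap)
qed

text \<open>The hypothesis on the moments concerns the union of the blocks, whereas the sum takes exactly one
  point from each block: antisymmetry removes the terms with two points in the same block.\<close>

lemma sum_vdm_blocks_eq_0:
  fixes v w :: "'p \<Rightarrow> 'a::field_char_0"
  assumes I: "finite I" "t \<in> I"
    and G: "\<And>r. r \<in> I \<Longrightarrow> finite (G r)" "disjoint_family_on G I"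
    and moments: "\<And>g. degree g < card I \<Longrightarrow> (\<Sum>p\<in>(\<Union>r\<in>I. G r). poly g (v p) * w p) = 0"
  shows "(\<Sum>X\<in>Pi\<^sub>E I G. vdm I (\<lambda>r. v (X r)) * (\<Prod>r\<in>I. w (X r))) = 0"
proof -
  define \<phi> where "\<phi> X = vdm I (\<lambda>r. v (X r)) * (\<Prod>r\<in>I. w (X r))" for X
  obtain \<epsilon> where \<epsilon>: "\<And>X::'b \<Rightarrow> 'a. vdm I X = \<epsilon> * (\<Prod>s\<in>I-{t}. X s - X t) * vdm (I - {t}) X"
    using vdm_remove I by blast
  \<comment> \<open>With the other coordinates frozen, the Vandermonde product is a polynomial of
    degree \<open>card I - 1\<close> in \<open>v p\<close>, so the moment hypothesis
    applies.\<close>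
  have all: "(\<Sum>p\<in>(\<Union>r\<in>I. G r). \<phi> (Y(t := p))) = 0" for Y
  proof -
    define g where "g = (\<Prod>s\<in>I-{t}. [:v (Y s), -1:])"
    define c where "c = \<epsilon> * vdm (I - {t}) (\<lambda>r. v (Y r)) * (\<Prod>r\<in>I-{t}. w (Y r))"
    have "degree g = card I - 1"
      using I by (simp add: g_def degree_prod_eq_sum_degree)
    then have "degree g < card I"
      using I by (metis card_gt_0_iff diff_less empty_iff zero_less_one)
    have "\<phi> (Y(t := p)) = c * (poly g (v p) * w p)" for p
    proof -
      have "vdm (I - {t}) (\<lambda>r. v ((Y(t := p)) r)) = vdm (I - {t}) (\<lambda>r. v (Y r))"
        by (intro vdm_cong) auto
      moreover have "(\<Prod>s\<in>I-{t}. v ((Y(t := p)) s) - v p) = poly g (v p)"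
        unfolding g_def poly_prod by (intro prod.cong) auto
      moreover have "(\<Prod>r\<in>I. w ((Y(t := p)) r)) = w p * (\<Prod>r\<in>I-{t}. w (Y r))"
        using I by (subst prod.remove[of I t]) (auto intro!: prod.cong)
      ultimately show ?thesis
        by (simp add: \<phi>_def c_def \<epsilon>)
    qed
    then show ?thesis
      using moments[OF \<open>degree g < card I\<close>] by (simp flip: sum_distrib_left)
  qed
  have swap: "(\<Sum>Y\<in>Pi\<^sub>E (I - {t}) G. \<Sum>p\<in>G u. \<phi> (Y(t := p))) = 0" if u: "u \<in> I" "u \<noteq> t" for u
  proof -
    \<comment> \<open>Now the coordinates \<open>t\<close> and \<open>u\<close> both range over
      \<open>G u\<close>, so that exchanging them is an involution of the index set; it reverses the
      sign of each term.\<close>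
    define H where "H = G(t := G u)"
    let ?\<tau> = "\<lambda>X::'b \<Rightarrow> 'p. X \<circ> Transposition.transpose t u"
    have H: "?\<tau> X \<in> Pi\<^sub>E I H" if "X \<in> Pi\<^sub>E I H" for X
    proof (rule PiE_I)
      fix r assume "r \<in> I"
      then show "?\<tau> X r \<in> H r"
        using that I u PiE_mem[OF that, of "Transposition.transpose t u r"]
        by (auto simp: H_def Transposition.transpose_def split: if_splits)
    next
      fix r assume "r \<notin> I"
      then show "?\<tau> X r = undefined"
        using that I u by (auto simp: Transposition.transpose_def split: if_splits)
    qed
    have "\<phi> (?\<tau> X) = - \<phi> X" for X
    proof -
      have "vdm I (\<lambda>r. v (?\<tau> X r)) = - vdm I (\<lambda>r. v (X r))"
        using vdm_swap[of I t u "\<lambda>r. v (X r)"] I u by (simp add: o_def)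
      moreover have "(\<Prod>r\<in>I. w (?\<tau> X r)) = (\<Prod>r\<in>I. w (X r))"
        using I u
        by (intro prod.reindex_bij_witness[of _ "Transposition.transpose t u" "Transposition.transpose t u"])
           (auto simp: Transposition.transpose_def)
      ultimately show ?thesis by (simp add: \<phi>_def)
    qed
    then have "(\<Sum>X\<in>Pi\<^sub>E I H. \<phi> X) = (\<Sum>X\<in>Pi\<^sub>E I H. - \<phi> X)"
      by (intro sum.reindex_bij_witness[of _ ?\<tau> ?\<tau>]) (auto simp: H o_assoc[symmetric] simp del: o_apply)
    then have "(\<Sum>X\<in>Pi\<^sub>E I H. \<phi> X) = 0"
      by (simp add: sum_negf)
    moreover have "Pi\<^sub>E (I - {t}) H = Pi\<^sub>E (I - {t}) G"
      by (intro PiE_cong) (auto simp: H_def)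
    ultimately show ?thesis
      using I by (simp add: sum_PiE_remove[of t] H_def)
  qed
  \<comment> \<open>The blocks \<open>u \<noteq> t\<close> contribute 0 and are added only to
    complete the range of \<open>p\<close> to the union of all blocks.\<close>
  have "(\<Sum>X\<in>Pi\<^sub>E I G. \<phi> X) = (\<Sum>u\<in>I. \<Sum>Y\<in>Pi\<^sub>E (I - {t}) G. \<Sum>p\<in>G u. \<phi> (Y(t := p)))"
    using I swap by (subst sum.remove[of I t]) (auto simp: sum_PiE_remove[of t])
  also have "\<dots> = (\<Sum>Y\<in>Pi\<^sub>E (I - {t}) G. \<Sum>u\<in>I. \<Sum>p\<in>G u. \<phi> (Y(t := p)))"
    by (rule sum.swap)
  also have "\<dots> = (\<Sum>Y\<in>Pi\<^sub>E (I - {t}) G. \<Sum>p\<in>(\<Union>r\<in>I. G r). \<phi> (Y(t := p)))"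
    using I G by (intro sum.cong refl sum.UNION_disjoint[symmetric]) (auto simp: disjoint_family_on_def)
  also have "\<dots> = 0"
    by (simp only: all sum.neutral_const)
  finally show ?thesis
    by (simp only: \<phi>_def)
qed

section \<open>The interpolation nodes and the kernel\<close>

text \<open>Explains the weight \<open>q ^ (\<Sum>r=1..n. (r - 1) * k r)\<close>: it supplies one
  factor \<open>q ^ k s\<close> to each pair r < s.\<close>

lemma prod_upper_triangle:
  fixes c :: "nat \<Rightarrow> 'a::comm_monoid_mult"
  shows "(\<Prod>r=1..n. \<Prod>s=r+1..n. c s) = (\<Prod>s=1..n. c s ^ (s - 1))"
proof (induction n)
  case (Suc n)
  have "(\<Prod>r=1..n. \<Prod>s=r+1..Suc n. c s) = (\<Prod>r=1..n. (\<Prod>s=r+1..n. c s) * c (Suc n))"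
    by (intro prod.cong refl) (simp add: prod.nat_ivl_Suc')
  then show ?case
    using Suc by (simp add: prod.distrib prod.nat_ivl_Suc')
qed simp

lemma prod_square_split:
  fixes G :: "nat \<Rightarrow> nat \<Rightarrow> 'a::comm_monoid_mult"
  shows "(\<Prod>r=1..n. \<Prod>s=1..n. G r s) = (\<Prod>r=1..n. G r r * (\<Prod>s=r+1..n. G r s * G s r))"
proof (induction n)
  case (Suc n)
  have "(\<Prod>r=1..Suc n. \<Prod>s=1..Suc n. G r s) = 
     (\<Prod>r=1..n. (\<Prod>s=1..n. G r s) * G r (Suc n)) * ((\<Prod>s=1..n. G (Suc n) s) * G (Suc n) (Suc n))"
    by (simp add: prod.nat_ivl_Suc' mult.commute)
  also have "\<dots> = (\<Prod>r=1..n. \<Prod>s=1..n. G r s) * 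
      (\<Prod>r=1..n. G r (Suc n) * G (Suc n) r) * G (Suc n) (Suc n)"
    by (simp add: prod.distrib mult_ac)
  also have "\<dots> = (\<Prod>r=1..n. G r r * (\<Prod>s=r+1..n. G r s * G s r) * (G r (Suc n) * G (Suc n) r)) 
      * G (Suc n) (Suc n)"
    unfolding Suc by (simp add: prod.distrib mult_ac)
  also have "(\<Prod>r=1..n. G r r * (\<Prod>s=r+1..n. G r s * G s r) * (G r (Suc n) * G (Suc n) r)) =
     (\<Prod>r=1..n. G r r * (\<Prod>s=r+1..Suc n. G r s * G s r))"
    by (intro prod.cong refl) (simp add: prod.nat_ivl_Suc' mult_ac)
  finally show ?case
    by (simp add: prod.nat_ivl_Suc' mult_ac)
qed simp

section \<open>Shifted factorials at integer powers of q\<close>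

lemma powi_minus_nat: "q powi (- int m) = inverse (q ^ m)" for q :: "'a::field"
  by (simp add: power_int_minus)

text \<open>Replacing y q^j by y q^(j+1) moves the string of factors by one place up to a power of
  q, so only the two end factors change; they are the next factors of the two shifted factorials.
  The identity is multiplied out because factors may vanish.\<close>

lemma prod_nodes_shift:
  fixes q x y :: complex
  assumes "q \<noteq> 0" "x \<noteq> 0"
  shows "(\<Prod>i\<le>M. y * q ^ j - x * q ^ i) * qpoch q (q powi (- int M) * y / x) j =
         (\<Prod>i\<le>M. y - x * q ^ i) * qpoch q (q * y / x) j"
proof (induction j)
  case (Suc j)
  define P where "P = (\<Prod>i<M. y * q ^ j - x * q ^ i)"
  have "(\<Prod>i\<le>M. y * q ^ Suc j - x * q ^ i) = (y * q ^ Suc j - x) * (\<Prod>i<M. q * (y * q ^ j - x * q ^ i))"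
    by (subst prod.atMost_shift) (simp add: right_diff_distrib mult_ac)
  also have "\<dots> = (y * q ^ Suc j - x) * (q ^ M * P)"
    by (simp only: prod.distrib prod_constant card_lessThan P_def)
  finally have eq: "(\<Prod>i\<le>M. y * q ^ Suc j - x * q ^ i) = (y * q ^ Suc j - x) * (q ^ M * P)" .
  have "(\<Prod>i\<le>M. y * q ^ Suc j - x * q ^ i) * (1 - q powi (- int M) * y / x * q ^ j) =
      (1 - q * y / x * q ^ j) * (P * (y * q ^ j - x * q ^ M))"
    unfolding eq using assms by (simp add: powi_minus_nat field_simps)
  also have "\<dots> = (1 - q * y / x * q ^ j) * (\<Prod>i\<le>M. y * q ^ j - x * q ^ i)"
    by (simp add: P_def flip: lessThan_Suc_atMost)
  finally show ?case
    using Suc by (simp add: qpoch_Suc mult_ac)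
qed simp

text \<open>The case x = y of the preceding shift, with the vanishing factor \<open>i = j\<close>
  left out. Leaving it out loses one power of q at each step, which accounts for
  \<open>q ^ j\<close>.\<close>

lemma prod_own_nodes_shift:
  fixes q y :: complex
  assumes "q \<noteq> 0" "y \<noteq> 0" "j \<le> M"
  shows "(\<Prod>i\<in>{..M}-{j}. y * q ^ j - y * q ^ i) * qpoch q (q powi (- int M) * y / y) j * q ^ j =
         (\<Prod>i\<in>{..M}-{0}. y - y * q ^ i) * qpoch q (q * y / y) j"
  using assms(3)
proof (induction j)
  case (Suc j)
  then obtain L where L: "M = Suc L" "j \<le> L"
    by (cases M) auto
  define P where "P = (\<Prod>i\<in>{..L}-{j}. y * q ^ j - y * q ^ i)"
  have "{..M} - {Suc j} = insert 0 (Suc ` ({..L} - {j}))"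
    using L by (simp add: atMost_Suc_eq_insert_0 image_set_diff insert_Diff_if)
  then have "(\<Prod>i\<in>{..M}-{Suc j}. y * q ^ Suc j - y * q ^ i) =
      (y * q ^ Suc j - y) * (\<Prod>i\<in>{..L}-{j}. q * (y * q ^ j - y * q ^ i))"
    by (simp add: prod.reindex algebra_simps)
  also have "\<dots> = (y * q ^ Suc j - y) * q ^ L * P"
    using L by (simp add: prod.distrib P_def)
  finally have 1: "(\<Prod>i\<in>{..M}-{Suc j}. y * q ^ Suc j - y * q ^ i) = (y * q ^ Suc j - y) * q ^ L * P" .
  have "{..M} - {j} = insert M ({..L} - {j})" "M \<notin> {..L} - {j}"
    using L by auto
  then have 2: "(\<Prod>i\<in>{..M}-{j}. y * q ^ j - y * q ^ i) = (y * q ^ j - y * q ^ M) * P"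
    by (simp add: P_def)
  have 3: "(\<Prod>i\<in>{..M}-{Suc j}. y * q ^ Suc j - y * q ^ i) * (1 - q powi (- int M) * y / y * q ^ j) * q
      = (\<Prod>i\<in>{..M}-{j}. y * q ^ j - y * q ^ i) * (1 - q * y / y * q ^ j)"
    unfolding 1 2 powi_minus_nat using assms L by (simp add: field_simps)
  have "(\<Prod>i\<in>{..M}-{Suc j}. y * q ^ Suc j - y * q ^ i) *
      qpoch q (q powi (- int M) * y / y) (Suc j) * q ^ Suc j =
     ((\<Prod>i\<in>{..M}-{Suc j}. y * q ^ Suc j - y * q ^ i) * (1 - q powi (- int M) * y / y * q ^ j) * q) *
     (qpoch q (q powi (- int M) * y / y) j * q ^ j)"
    by (simp only: qpoch_Suc power_Suc mult_ac)
  also have "\<dots> = ((\<Prod>i\<in>{..M}-{j}. y * q ^ j - y * q ^ i) * qpoch q (q powi (- int M) * y / y) j * q ^ j) *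
     (1 - q * y / y * q ^ j)"
    unfolding 3 by (simp only: mult_ac)
  also have "\<dots> = (\<Prod>i\<in>{..M}-{0}. y - y * q ^ i) * qpoch q (q * y / y) (Suc j)"
    using Suc by (simp only: qpoch_Suc Suc_leD mult.assoc)
  finally show ?case .
qed simp

text \<open>Up to monomials both sides are the product of 1 - q^j u over -b \<le> j \<le> a. Each
  side reflects b of its factors into the variable 1/u, so the signs and the powers of u agree, and
  the powers of q differ by b(a+1).\<close>

lemma qpoch_pair_reflect:
  fixes q u :: complex
  assumes "q \<noteq> 0" "u \<noteq> 0"
  shows "(1 - q powi (int a - int b) * u) * qpoch q (q powi (- int b) * u) a *
           qpoch q (q powi (- int a) / u) b * q ^ (b * (a + 1)) =
         (1 - u) * qpoch q (q * u) a * qpoch q (q / u) b"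
proof (induction b)
  case 0
  have "qpoch q u (a + 1) = qpoch q u (1 + a)"
    by simp
  then show ?case
    unfolding qpoch_add by (simp add: qpoch_Suc mult_ac)
next
  case (Suc b)
  define z where "z = inverse q ^ Suc b * u"
  have z: "q powi (- int (Suc b)) * u = z" "z * q = q powi (- int b) * u"
      "q powi (int a - int (Suc b)) * u = z * q ^ a"
    using assms by (simp_all add: z_def powi_minus_nat power_int_diff field_simps del: of_nat_Suc)
  have "qpoch q z (a + 1) = qpoch q z (1 + a)"
    by simp
  then have *: "(1 - z * q ^ a) * qpoch q z a = (1 - z) * qpoch q (z * q) a"
    unfolding qpoch_add by (simp add: qpoch_Suc mult_ac)
  have **: "(1 - z) * (1 - q powi (- int a) / u * q ^ b) * q ^ (a + 1) =
      (1 - q powi (int a - int b) * u) * (1 - q / u * q ^ b)"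
    using assms by (simp add: z_def powi_minus_nat power_int_diff field_simps)
  have "(1 - q powi (int a - int (Suc b)) * u) * qpoch q (q powi (- int (Suc b)) * u) a *
           qpoch q (q powi (- int a) / u) (Suc b) * q ^ (Suc b * (a + 1)) = 
        ((1 - z * q ^ a) * qpoch q z a) * (1 - q powi (- int a) / u * q ^ b) * q ^ (a + 1) *
           qpoch q (q powi (- int a) / u) b * q ^ (b * (a + 1))"
    unfolding z qpoch_Suc by (simp add: power_add mult_ac)
  also have "\<dots> = ((1 - z) * (1 - q powi (- int a) / u * q ^ b) * q ^ (a + 1)) *
        qpoch q (z * q) a * qpoch q (q powi (- int a) / u) b * q ^ (b * (a + 1))"
    unfolding * by (simp add: mult_ac)
  also have "\<dots> = (1 - q / u * q ^ b) * ((1 - q powi (int a - int b) * u) * qpoch q (q powi (- int b) * u) a *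
           qpoch q (q powi (- int a) / u) b * q ^ (b * (a + 1)))"
    unfolding ** z by (simp add: mult_ac)
  also have "\<dots> = (1 - u) * qpoch q (q * u) a * qpoch q (q / u) (Suc b)"
    unfolding Suc qpoch_Suc by (simp add: mult_ac)
  finally show ?case .
qed

text \<open>Reversing the factors gives (q^{-a})_a = (-1)^a q^{-a(a+1)/2} (q)_a; squaring disposes
  of the sign and of the half in the exponent.\<close>

lemma qpoch_neg_square:
  fixes q :: complex
  assumes "q \<noteq> 0"
  shows "(qpoch q (q powi (- int a)) a)\<^sup>2 * q ^ (a * (a + 1)) = (qpoch q q a)\<^sup>2"
proof (induction a)
  case (Suc a)
  have 1: "qpoch q (q powi (- int (Suc a))) (Suc a) =
      (1 - q powi (- int (Suc a))) * qpoch q (q powi (- int a)) a"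
    using qpoch_add[of q "q powi (- int (Suc a))" 1 a] assms
    by (simp add: qpoch_Suc powi_minus_nat field_simps del: of_nat_Suc)
  have "(1 - q powi (- int (Suc a))) * q ^ Suc a = q * q ^ a - 1"
    using assms by (simp add: powi_minus_nat field_simps del: of_nat_Suc)
  then have "((1 - q powi (- int (Suc a))) * q ^ Suc a)\<^sup>2 = (1 - q * q ^ a)\<^sup>2"
    by (simp only: power2_commute)
  then have 2: "(1 - q powi (- int (Suc a)))\<^sup>2 * q ^ (Suc a * 2) = (1 - q * q ^ a)\<^sup>2"
    by (simp only: power_mult_distrib power_mult)
  have 3: "Suc a * (Suc a + 1) = Suc a * 2 + a * (a + 1)"
    by simp
  have "(qpoch q (q powi (- int (Suc a))) (Suc a))\<^sup>2 * q ^ (Suc a * (Suc a + 1)) =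
     ((1 - q powi (- int (Suc a)))\<^sup>2 * q ^ (Suc a * 2)) * ((qpoch q (q powi (- int a)) a)\<^sup>2 * q ^ (a * (a + 1)))"
    unfolding 1 3 power_add[of q "Suc a * 2"] power_mult_distrib by (simp only: mult_ac)
  then show ?case
    unfolding Suc 2 qpoch_Suc by (simp only: power_mult_distrib mult.commute)
qed simp

text \<open>On the left are the exponents supplied by \<open>qpoch_neg_square\<close> on the
  diagonal and, doubled by squaring, by \<open>qpoch_pair_reflect\<close> for each pair; on the
  right are those carried by the two coefficient matrices.\<close>

lemma sum_pairs_eq:
  fixes M :: "nat \<Rightarrow> nat"
  shows "(\<Sum>r=1..n. M r * (M r + 1) + (\<Sum>s=r+1..n. 2 * (M s * (M r + 1)))) =
     msize n M * msize n M + (\<Sum>r=1..n. r * M r) + (\<Sum>r=1..n. (r - 1) * M r)"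
proof (induction n)
  case (Suc n)
  have "(\<Sum>r=1..n. M r * (M r + 1) + (\<Sum>s=r+1..Suc n. 2 * (M s * (M r + 1)))) =
     (\<Sum>r=1..n. M r * (M r + 1) + (\<Sum>s=r+1..n. 2 * (M s * (M r + 1))) + 2 * M (Suc n) * (M r + 1))"
    by (intro sum.cong refl) simp
  also have "\<dots> = msize n M * msize n M + (\<Sum>r=1..n. r * M r) + (\<Sum>r=1..n. (r - 1) * M r) 
       + 2 * M (Suc n) * (msize n M + n)"
  proof -
    have "(\<Sum>r=1..n. 2 * M (Suc n) * (M r + 1)) = 2 * M (Suc n) * (msize n M + n)"
      unfolding sum_distrib_left[symmetric] sum.distrib msize_def by simp
    then show ?thesis
      unfolding sum.distrib[of _ "\<lambda>r. 2 * M (Suc n) * (M r + 1)"] Suc by simp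
  qed
  finally show ?case
    by (simp add: msize_def algebra_simps)
qed (simp add: msize_def)

locale qnodes =
  fixes n :: nat and q :: complex and x :: "nat \<Rightarrow> complex"
  assumes q_nonzero: "q \<noteq> 0"
    and x_nonzero: "r \<in> {1..n} \<Longrightarrow> x r \<noteq> 0"
    and x_distinct: "r \<in> {1..n} \<Longrightarrow> s \<in> {1..n} \<Longrightarrow> r < s \<Longrightarrow> x r \<noteq> x s"
    and qpoch_nodes_nonzero: "r \<in> {1..n} \<Longrightarrow> s \<in> {1..n} \<Longrightarrow> qpoch q (q * x r / x s) k \<noteq> 0"
begin

text \<open>For unequal exponents, cancelling powers of q leaves a relation x_r = x_s q^(d+1), which
  makes the last factor of \<open>qpoch q (q * x s / x r) (Suc d)\<close> vanish. The case r = s is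
  included and keeps the powers of q distinct.\<close>

lemma node_inj:
  assumes "r \<in> {1..n}" "s \<in> {1..n}" "x r * q ^ i = x s * q ^ j"
  shows "r = s \<and> i = j"
proof -
  have ne: "x r \<noteq> x s * q ^ Suc d" if "r \<in> {1..n}" "s \<in> {1..n}" for r s d
  proof
    assume "x r = x s * q ^ Suc d"
    then have "qpoch q (q * x s / x r) (Suc d) = 0"
      using x_nonzero[OF that(1)] by (simp add: qpoch_Suc field_simps)
    then show False
      using qpoch_nodes_nonzero that by blast
  qed
  consider d where "i = j + Suc d" | d where "j = i + Suc d" | "i = j"
    by (metis less_imp_Suc_add linorder_cases add_Suc_right)
  then show ?thesis
  proof cases
    case 1
    then have "x s = x r * q ^ Suc d"
      using assms(3) q_nonzero by (simp add: power_add mult_ac)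
    then show ?thesis using ne assms by blast
  next
    case 2
    then have "x r = x s * q ^ Suc d"
      using assms(3) q_nonzero by (simp add: power_add mult_ac)
    then show ?thesis using ne assms by blast
  next
    case 3
    then have "x r = x s"
      using assms(3) q_nonzero by simp
    then show ?thesis
      using x_distinct assms 3 by (metis linorder_neqE_nat)
  qed
qed

text \<open>This is W'(x_r q^j) for the monic polynomial W with the zeros x_s q^i, i \<le> M_s. The
  r-th block stands apart because the zero at the point itself is omitted there, so it obeys a
  different shift rule.\<close>

definition node_prod :: "(nat \<Rightarrow> nat) \<Rightarrow> nat \<Rightarrow> nat \<Rightarrow> complex" where
  "node_prod M r j = (\<Prod>i\<in>{..M r}-{j}. x r * q ^ j - x r * q ^ i) *
     (\<Prod>s\<in>{1..n}-{r}. \<Prod>i\<le>M s. x r * q ^ j - x s * q ^ i)"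

lemma node_prod_eq:
  assumes "r \<in> {1..n}"
  shows "node_prod M r j = (\<Prod>(s, i) \<in> (SIGMA s:{1..n}. {..M s}) - {(r, j)}. x r * q ^ j - x s * q ^ i)"
proof -
  have "(SIGMA s:{1..n}. {..M s}) - {(r, j)} =
     (SIGMA s:{1..n}. if s = r then {..M r} - {j} else {..M s})"
    by (auto split: if_splits)
  then have "(\<Prod>(s, i) \<in> (SIGMA s:{1..n}. {..M s}) - {(r, j)}. x r * q ^ j - x s * q ^ i) =
     (\<Prod>s\<in>{1..n}. \<Prod>i\<in>(if s = r then {..M r} - {j} else {..M s}). x r * q ^ j - x s * q ^ i)"
    by (subst prod.Sigma) auto
  also have "\<dots> = node_prod M r j"
    unfolding node_prod_def using assms by (subst prod.remove[of _ r]) (auto intro!: prod.cong)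
  finally show ?thesis ..
qed

lemma node_diff_eq_0_iff:
  assumes "r \<in> {1..n}" "s \<in> {1..n}"
  shows "x r * q ^ i - x s * q ^ j = 0 \<longleftrightarrow> r = s \<and> i = j"
  using node_inj[OF assms, of i j] by auto

lemma node_prod_nonzero:
  assumes "r \<in> {1..n}"
  shows "node_prod M r j \<noteq> 0"
proof -
  have "(case p of (s, i) \<Rightarrow> x r * q ^ j - x s * q ^ i) \<noteq> 0"
    if p: "p \<in> (SIGMA s:{1..n}. {..M s}) - {(r, j)}" for p
  proof (cases p)
    case (Pair s i)
    then have "s \<in> {1..n}" "\<not> (r = s \<and> j = i)"
      using p by auto
    then show ?thesis
      using node_diff_eq_0_iff[OF assms, of s j i] unfolding Pair prod.case by blast
  qed
  then show ?thesis
    unfolding node_prod_eq[OF assms] by (subst prod_zero_iff) blast+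
qed

text \<open>Identifies the quotient of shifted factorials in the kernel as W'(x_r) / W'(x_r q^j), up
  to \<open>q ^ j\<close>.\<close>

lemma node_prod_shift:
  assumes "r \<in> {1..n}" "j \<le> M r"
  shows "node_prod M r j * (\<Prod>s=1..n. qpoch q (q powi (- int (M s)) * x r / x s) j) * q ^ j =
         node_prod M r 0 * (\<Prod>s=1..n. qpoch q (q * x r / x s) j)"
proof -
  have own: "(\<Prod>i\<in>{..M r}-{j}. x r * q ^ j - x r * q ^ i) *
      qpoch q (q powi (- int (M r)) * x r / x r) j * q ^ j =
         (\<Prod>i\<in>{..M r}-{0}. x r - x r * q ^ i) * qpoch q (q * x r / x r) j"
    using assms q_nonzero x_nonzero by (intro prod_own_nodes_shift) auto
  have other: "(\<Prod>s\<in>{1..n}-{r}. \<Prod>i\<le>M s. x r * q ^ j - x s * q ^ i) *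
        (\<Prod>s\<in>{1..n}-{r}. qpoch q (q powi (- int (M s)) * x r / x s) j) =
      (\<Prod>s\<in>{1..n}-{r}. \<Prod>i\<le>M s. x r - x s * q ^ i) *
        (\<Prod>s\<in>{1..n}-{r}. qpoch q (q * x r / x s) j)"
    unfolding prod.distrib[symmetric]
    using q_nonzero x_nonzero by (intro prod.cong refl prod_nodes_shift) auto
  have "node_prod M r j * (\<Prod>s=1..n. qpoch q (q powi (- int (M s)) * x r / x s) j) * q ^ j =
     ((\<Prod>i\<in>{..M r}-{j}. x r * q ^ j - x r * q ^ i) *
      qpoch q (q powi (- int (M r)) * x r / x r) j * q ^ j) *
     ((\<Prod>s\<in>{1..n}-{r}. \<Prod>i\<le>M s. x r * q ^ j - x s * q ^ i) *
        (\<Prod>s\<in>{1..n}-{r}. qpoch q (q powi (- int (M s)) * x r / x s) j))"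
    unfolding node_prod_def prod.remove[OF finite_atLeastAtMost assms(1)] by (simp only: mult_ac)
  also have "\<dots> = node_prod M r 0 * (\<Prod>s=1..n. qpoch q (q * x r / x s) j)"
    unfolding own other node_prod_def prod.remove[OF finite_atLeastAtMost assms(1)] power_0 mult_1_right
    by (simp only: mult_ac)
  finally show ?thesis .
qed

lemma vdm_nodes_nonzero: "vdm {1..n} x \<noteq> 0"
proof -
  have "(\<Prod>s\<in>{s\<in>{1..n}. r < s}. x s - x r) \<noteq> 0" if "r \<in> {1..n}" for r
    using x_distinct[OF that] by force
  then show ?thesis
    by (simp add: vdm_def)
qed

lemma vdm_atLeastAtMost: "vdm {1..n} X = (\<Prod>r=1..n. \<Prod>s=r+1..n. X s - X r)"
  unfolding vdm_def by (intro prod.cong refl) auto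

text \<open>The power of q gives each pair r < s the factor \<open>q ^ k s\<close> that clears the
  negative exponent in 1 - q^(k_r - k_s) x_r / x_s.\<close>

lemma vandermonde_ratio_eq:
  "vandermonde_ratio n q x k * q ^ (\<Sum>r=1..n. (r - 1) * k r) * vdm {1..n} x =
     vdm {1..n} (\<lambda>r. x r * q ^ k r)"
proof -
  have "q ^ (\<Sum>r=1..n. (r - 1) * k r) = (\<Prod>s=1..n. (q ^ k s) ^ (s - 1))"
    by (simp add: power_sum mult.commute flip: power_mult)
  also have "\<dots> = (\<Prod>r=1..n. \<Prod>s=r+1..n. q ^ k s)"
    by (rule prod_upper_triangle[symmetric])
  finally have eq: "q ^ (\<Sum>r=1..n. (r - 1) * k r) = (\<Prod>r=1..n. \<Prod>s=r+1..n. q ^ k s)" .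
  have "vandermonde_ratio n q x k * q ^ (\<Sum>r=1..n. (r - 1) * k r) * vdm {1..n} x =
    (\<Prod>r=1..n. \<Prod>s=r+1..n. 
      (1 - q powi (int (k r) - int (k s)) * x r / x s) / (1 - x r / x s) * q ^ k s * (x s - x r))"
    by (simp only: eq vandermonde_ratio_def vdm_atLeastAtMost prod.distrib)
  also have "\<dots> = vdm {1..n} (\<lambda>r. x r * q ^ k r)"
    unfolding vdm_atLeastAtMost
  proof (intro prod.cong refl)
    fix r s assume *: "r \<in> {1..n}" "s \<in> {r+1..n}"
    then have "x r \<noteq> x s" "x s \<noteq> 0"
      using x_distinct[of r s] x_nonzero[of s] by auto
    then show "(1 - q powi (int (k r) - int (k s)) * x r / x s) / (1 - x r / x s) * q ^ k s * (x s - x r)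
       = x s * q ^ k s - x r * q ^ k r"
      using q_nonzero by (simp add: power_int_diff divide_simps)
  qed
  finally show ?thesis .
qed

text \<open>The part common to both matrices: for a_s = q^(M_s + 1) the outer argument q x_r / (x_s
  a_s) equals q^(-M_s) x_r / x_s, which has the same form as the inner one.\<close>

definition qkernel :: "(nat \<Rightarrow> nat) \<Rightarrow> (nat \<Rightarrow> nat) \<Rightarrow> complex" where
  "qkernel M k = vandermonde_ratio n q x k *
     (\<Prod>r=1..n. \<Prod>s=1..n. qpoch q (q powi (- int (M s)) * x r / x s) (k r) / qpoch q (q * x r / x s) (k r))"

text \<open>The kernel as a function of its second index: a Vandermonde product in the points x_r
  q^(k_r) over the derivatives of W there, times a constant depending on \<open>M\<close>.\<close>

lemma qkernel_nodes:
  assumes "\<And>r. r \<in> {1..n} \<Longrightarrow> k r \<le> M r"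
  shows "qkernel M k * q ^ (\<Sum>r=1..n. r * k r) =
     (\<Prod>r=1..n. node_prod M r 0) / vdm {1..n} x *
     (vdm {1..n} (\<lambda>r. x r * q ^ k r) / (\<Prod>r=1..n. node_prod M r (k r)))"
proof -
  \<comment> \<open>The part with r - 1 belongs to the Vandermonde ratio; the remaining
    \<open>q ^ k r\<close> is the one demanded by \<open>node_prod_shift\<close>.\<close>
  have "(\<Sum>r=1..n. r * k r) = (\<Sum>r=1..n. (r - 1) * k r + k r)"
    by (intro sum.cong refl) (auto simp: algebra_simps)
  then have "q ^ (\<Sum>r=1..n. r * k r) = q ^ (\<Sum>r=1..n. (r - 1) * k r) * (\<Prod>r=1..n. q ^ k r)"
    by (simp add: sum.distrib power_add power_sum)
  then have "qkernel M k * q ^ (\<Sum>r=1..n. r * k r) * vdm {1..n} x =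
     (vandermonde_ratio n q x k * q ^ (\<Sum>r=1..n. (r - 1) * k r) * vdm {1..n} x) *
     (\<Prod>r=1..n. (\<Prod>s=1..n. qpoch q (q powi (- int (M s)) * x r / x s) (k r) /
        qpoch q (q * x r / x s) (k r)) * q ^ k r)"
    by (simp only: qkernel_def prod.distrib mult_ac)
  also have "\<dots> = vdm {1..n} (\<lambda>r. x r * q ^ k r) *
     (\<Prod>r=1..n. node_prod M r 0 / node_prod M r (k r))"
    unfolding vandermonde_ratio_eq
  proof (intro arg_cong2[where f = "(*)"] prod.cong refl)
    fix r assume r: "r \<in> {1..n}"
    have "(\<Prod>s=1..n. qpoch q (q * x r / x s) (k r)) \<noteq> 0"
      using qpoch_nodes_nonzero[OF r] by simp
    then show "(\<Prod>s=1..n. qpoch q (q powi (- int (M s)) * x r / x s) (k r) /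
        qpoch q (q * x r / x s) (k r)) * q ^ k r = node_prod M r 0 / node_prod M r (k r)"
      using node_prod_shift[OF r, of "k r" M] assms[OF r] node_prod_nonzero[OF r, of M "k r"]
      unfolding prod_dividef by (simp add: field_simps)
  qed
  finally have "qkernel M k * q ^ (\<Sum>r=1..n. r * k r) = vdm {1..n} (\<lambda>r. x r * q ^ k r) *
     (\<Prod>r=1..n. node_prod M r 0 / node_prod M r (k r)) / vdm {1..n} x"
    using vdm_nodes_nonzero by (metis nonzero_mult_div_cancel_right)
  then show ?thesis
    by (simp only: prod_dividef times_divide_times_eq mult.commute times_divide_eq_right divide_divide_eq_left)
qed

lemma qkernel_eq_0:
  assumes "r \<in> {1..n}" "M r < k r"
  shows "qkernel M k = 0"
proof -
  \<comment> \<open>The factor with i = M_r is zero, and M_r < k_r puts it inside the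
    product.\<close>
  have "qpoch q (q powi (- int (M r)) * x r / x r) (k r) = 0"
    using assms q_nonzero x_nonzero[OF assms(1)]
    by (auto simp: qpoch_def powi_minus_nat intro!: prod_zero bexI[of _ "M r"])
  then show ?thesis
    unfolding qkernel_def using assms(1) by (auto intro!: bexI[of _ r])
qed

text \<open>A diagonal entry of the product of the matrices contains the square of the kernel. The
  indices r = s cancel by \<open>qpoch_neg_square\<close> and each pair r < s by
  \<open>qpoch_pair_reflect\<close>.\<close>

lemma qkernel_diagonal:
  "(qkernel M M)\<^sup>2 * q ^ (msize n M * msize n M + (\<Sum>r=1..n. r * M r) + (\<Sum>r=1..n. (r - 1) * M r)) = 1"
proof -
  define G where "G r s = qpoch q (q powi (- int (M s)) * x r / x s) (M r) / qpoch q (q * x r / x s) (M r)" for r s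
  have diag: "(G r r)\<^sup>2 * q ^ (M r * (M r + 1)) = 1" if "r \<in> {1..n}" for r
    using qpoch_neg_square[OF q_nonzero, of "M r"] qpoch_nodes_nonzero[OF that that, of "M r"] x_nonzero[OF that]
    by (simp add: G_def power_divide)
  have pair: "(1 - q powi (int (M r) - int (M s)) * x r / x s) / (1 - x r / x s) * (G r s * G s r) *
      q ^ (M s * (M r + 1)) = 1" if "r \<in> {1..n}" "s \<in> {r+1..n}" for r s
  proof -
    have *: "s \<in> {1..n}" "x r \<noteq> 0" "x s \<noteq> 0" "x r \<noteq> x s"
      using that x_nonzero[of r] x_nonzero[of s] x_distinct[of r s] by auto
    show ?thesis
      using qpoch_pair_reflect[of q "x r / x s" "M r" "M s"] q_nonzero *
        qpoch_nodes_nonzero[of r s "M r"] qpoch_nodes_nonzero[of s r "M s"] that(1)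
      by (simp add: G_def divide_simps mult_ac)
  qed
  define V where "V r = (\<Prod>s=r+1..n.
     (1 - q powi (int (M r) - int (M s)) * x r / x s) / (1 - x r / x s) * (G r s * G s r))" for r
  define U where "U r = (\<Prod>s=r+1..n. q ^ (M s * (M r + 1)))" for r
  have VU: "V r * U r = 1" if "r \<in> {1..n}" for r
    unfolding V_def U_def prod.distrib[symmetric] using pair[OF that] by (intro prod.neutral ballI)
  have K: "qkernel M M = (\<Prod>r=1..n. G r r * V r)"
    unfolding qkernel_def G_def[symmetric] prod_square_split vandermonde_ratio_def V_def
    by (simp only: prod.distrib mult_ac)
  have Q: "q ^ (msize n M * msize n M + (\<Sum>r=1..n. r * M r) + (\<Sum>r=1..n. (r - 1) * M r)) =
     (\<Prod>r=1..n. q ^ (M r * (M r + 1)) * (U r)\<^sup>2)"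
    unfolding sum_pairs_eq[symmetric] power_sum power_add[of _ "_ * _" "sum _ _"] U_def
    by (intro prod.cong refl arg_cong2[where f = "(*)"])
       (simp only: prod_power_distrib power_mult[symmetric] mult.commute[of _ 2])
  have "(\<Prod>r=1..n. G r r * V r)\<^sup>2 * (\<Prod>r=1..n. q ^ (M r * (M r + 1)) * (U r)\<^sup>2) =
     (\<Prod>r=1..n. ((G r r)\<^sup>2 * q ^ (M r * (M r + 1))) * (V r * U r)\<^sup>2)"
    by (simp only: prod.distrib power2_eq_square mult_ac)
  also have "\<dots> = 1"
    by (intro prod.neutral ballI) (simp only: diag VU, simp)
  finally show ?thesis
    unfolding K Q .
qed

end

section \<open>Inversion of the coefficient matrices\<close>

abbreviation idx_box :: "nat \<Rightarrow> (nat \<Rightarrow> nat) \<Rightarrow> (nat \<Rightarrow> nat) set" where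
  "idx_box n M \<equiv> \<Pi>\<^sub>E r\<in>{1..n}. {0..M r}"

lemma finite_idx_box: "finite (idx_box n M)"
  by (intro finite_PiE) auto

lemma mem_idx_box_iff: "k \<in> idx_box n M \<longleftrightarrow> k \<in> extensional {1..n} \<and> (\<forall>r\<in>{1..n}. k r \<le> M r)"
  by (auto simp: PiE_iff)

lemma idx_box_trans: "k \<in> idx_box n M \<Longrightarrow> M \<in> idx_box n N \<Longrightarrow> k \<in> idx_box n N"
  unfolding mem_idx_box_iff using order_trans by blast

lemma not_in_idx_boxE:
  assumes "k \<in> idx_box n N" "k \<notin> idx_box n M"
  obtains r where "r \<in> {1..n}" "M r < k r"
  using assms unfolding mem_idx_box_iff not_less[symmetric] by blast

lemma idx_box_msize_less:
  assumes "k \<in> idx_box n M" "M \<in> idx_box n N" "k \<noteq> M"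
  shows "msize n k < msize n M"
proof -
  have "\<exists>r\<in>{1..n}. k r \<noteq> M r"
    using assms extensionalityI[of k "{1..n}" M] unfolding mem_idx_box_iff by blast
  then show ?thesis
    unfolding msize_def using assms(1) unfolding mem_idx_box_iff
    by (intro sum_strict_mono_ex1) (auto intro: le_neq_implies_less)
qed

text \<open>From A B = 1 follows A (B A - 1) = 0, and a triangular \<open>A\<close> with nonzero
  diagonal has trivial kernel, by induction along \<mu>. \<open>E\<close> is the j-th column of B A
  - 1.\<close>

lemma triangular_inverse_commute:
  fixes A B :: "'i \<Rightarrow> 'i \<Rightarrow> 'a::field" and \<mu> :: "'i \<Rightarrow> nat"
  assumes S: "finite S"
    and tri: "\<And>i k. i \<in> S \<Longrightarrow> k \<in> S \<Longrightarrow> k \<noteq> i \<Longrightarrow> A i k \<noteq> 0 \<Longrightarrow> \<mu> k < \<mu> i"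
    and diag: "\<And>i. i \<in> S \<Longrightarrow> A i i \<noteq> 0"
    and inv: "\<And>i j. i \<in> S \<Longrightarrow> j \<in> S \<Longrightarrow> (\<Sum>k\<in>S. A i k * B k j) = (if i = j then 1 else 0)"
    and ij: "i \<in> S" "j \<in> S"
  shows "(\<Sum>k\<in>S. B i k * A k j) = (if i = j then 1 else 0)"
proof -
  define E where "E i = (\<Sum>k\<in>S. B i k * A k j) - (if i = j then 1 else 0)" for i
  have AE: "(\<Sum>i\<in>S. A l i * E i) = 0" if "l \<in> S" for l
  proof -
    have "(\<Sum>i\<in>S. A l i * (\<Sum>k\<in>S. B i k * A k j)) = (\<Sum>i\<in>S. \<Sum>k\<in>S. A l i * B i k * A k j)"
      by (simp add: sum_distrib_left mult.assoc)
    also have "\<dots> = (\<Sum>k\<in>S. (\<Sum>i\<in>S. A l i * B i k) * A k j)"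
      by (subst sum.swap) (simp add: sum_distrib_right)
    also have "\<dots> = (\<Sum>k\<in>S. if k = l then A k j else 0)"
      using that by (intro sum.cong refl) (simp add: inv)
    also have "\<dots> = A l j"
      using S that by simp
    finally have "(\<Sum>i\<in>S. A l i * (\<Sum>k\<in>S. B i k * A k j)) = A l j" .
    moreover have "(\<Sum>i\<in>S. A l i * (if i = j then 1 else 0)) = A l j"
      using S ij by (simp add: if_distrib cong: if_cong)
    ultimately show ?thesis
      by (simp add: E_def right_diff_distrib sum_subtractf)
  qed
  have "l \<in> S \<Longrightarrow> E l = 0" for l
  proof (induction "\<mu> l" arbitrary: l rule: less_induct)
    case less
    have "(\<Sum>i\<in>S - {l}. A l i * E i) = 0"
      using tri less by (intro sum.neutral) (metis DiffD1 DiffD2 insertI1 mult_eq_0_iff)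
    then have "A l l * E l = 0"
      using AE[OF less.prems] S less.prems by (simp add: sum.remove)
    then show ?case
      using diag less.prems by simp
  qed
  then show ?thesis
    using ij by (simp add: E_def)
qed

lemma mult_divide_cancel_swap:
  fixes T :: "'a::field"
  assumes "P * (Q * R) = S * T" "P \<noteq> 0" "S \<noteq> 0" "Q \<noteq> 0"
  shows "T * (A * (B / Q) / P) = A * B / S * R"
proof -
  have "T = P * (Q * R) / S"
    using assms by (simp add: field_simps)
  then show ?thesis
    using assms by (simp add: field_simps)
qed

section \<open>Interpolation sums and orthogonality of the two matrices\<close>

context qnodes
begin

text \<open>There are \<open>msize n M + n\<close> nodes, and the moment hypothesis tests against
  polynomials \<open>h\<close> of degree at most n - 1, so the degree of \<open>h * g\<close> stays
  within reach of Lagrange interpolation.\<close>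

lemma sum_idx_box_poly_eq_0:
  assumes "degree g < msize n M" "n \<ge> 1"
  shows "(\<Sum>k\<in>idx_box n M. vdm {1..n} (\<lambda>r. x r * q ^ k r) *
           (\<Prod>r=1..n. poly g (x r * q ^ k r) / node_prod M r (k r))) = 0"
proof -
  define Z where "Z = (SIGMA s:{1..n}. {..M s})"
  define v where "v = (\<lambda>(s, i). x s * q ^ i)"
  define w where "w p = poly g (v p) / (\<Prod>p'\<in>Z-{p}. v p - v p')" for p
  define G where "G r = {r} \<times> {..M r}" for r
  have Z: "(\<Union>r\<in>{1..n}. G r) = Z"
    by (auto simp: G_def Z_def)
  have fin: "finite Z"
    by (simp add: Z_def)
  have inj: "inj_on v Z"
    using node_inj unfolding inj_on_def Z_def v_def by fast
  have cardZ: "card Z = msize n M + n"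
  proof -
    have "card Z = (\<Sum>s=1..n. M s + 1)"
      by (simp add: Z_def)
    also have "\<dots> = msize n M + n"
      unfolding sum.distrib msize_def by simp
    finally show ?thesis .
  qed
  have "(\<Sum>X\<in>Pi\<^sub>E {1..n} G. vdm {1..n} (\<lambda>r. v (X r)) * (\<Prod>r\<in>{1..n}. w (X r))) = 0"
  proof (rule sum_vdm_blocks_eq_0)
    show "1 \<in> {1..n}" using assms by simp
    show "disjoint_family_on G {1..n}"
      by (auto simp: disjoint_family_on_def G_def)
    show "finite (G r)" for r
      by (simp add: G_def)
    fix h :: "complex poly" assume "degree h < card {1..n}"
    then have "degree (h * g) + 1 < card Z"
      using assms degree_mult_le[of h g] by (simp add: cardZ)
    from sum_poly_div_prod_diff_eq_0[OF fin inj this]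
    show "(\<Sum>p\<in>(\<Union>r\<in>{1..n}. G r). poly h (v p) * w p) = 0"
      unfolding Z w_def by simp
  qed simp
  also have "(\<Sum>X\<in>Pi\<^sub>E {1..n} G. vdm {1..n} (\<lambda>r. v (X r)) * (\<Prod>r\<in>{1..n}. w (X r))) =
     (\<Sum>k\<in>idx_box n M. vdm {1..n} (\<lambda>r. x r * q ^ k r) *
           (\<Prod>r=1..n. poly g (x r * q ^ k r) / node_prod M r (k r)))"
  \<comment> \<open>Choosing one node from each block is the same as choosing a multi-index: the
    r-th node is \<open>(r, k r)\<close>.\<close>
  proof (rule sum.reindex_bij_witness[of _ "\<lambda>k. \<lambda>r\<in>{1..n}. (r, k r)" "\<lambda>X. \<lambda>r\<in>{1..n}. snd (X r)"])
    fix X assume X: "X \<in> Pi\<^sub>E {1..n} G"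
    then have Xr: "X r = (r, snd (X r))" "snd (X r) \<le> M r" if "r \<in> {1..n}" for r
      using PiE_mem[OF X that] by (auto simp: G_def)
    have vX: "v (X r) = x r * q ^ snd (X r)" if "r \<in> {1..n}" for r
      using Xr(1)[OF that] unfolding v_def by (cases "X r") simp
    show "(\<lambda>r\<in>{1..n}. (r, (\<lambda>r\<in>{1..n}. snd (X r)) r)) = X"
      using X by (intro extensionalityI[of _ "{1..n}"]) (auto simp: Xr(1)[symmetric] PiE_def)
    show "(\<lambda>r\<in>{1..n}. snd (X r)) \<in> idx_box n M"
      using Xr(2) by auto
    have "vdm {1..n} (\<lambda>r. x r * q ^ (\<lambda>r\<in>{1..n}. snd (X r)) r) = vdm {1..n} (\<lambda>r. v (X r))"
      by (intro vdm_cong) (simp add: vX)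
    moreover have "(\<Prod>r=1..n. poly g (x r * q ^ (\<lambda>r\<in>{1..n}. snd (X r)) r) /
        node_prod M r ((\<lambda>r\<in>{1..n}. snd (X r)) r)) = (\<Prod>r\<in>{1..n}. w (X r))"
    proof (intro prod.cong refl)
      fix r assume r: "r \<in> {1..n}"
      have W: "(\<Prod>p'\<in>Z-{X r}. x r * q ^ snd (X r) - v p') = node_prod M r (snd (X r))"
        unfolding node_prod_eq[OF r] Z_def[symmetric] Xr(1)[OF r, symmetric]
        by (intro prod.cong refl) (simp add: v_def case_prod_unfold)
      show "poly g (x r * q ^ (\<lambda>r\<in>{1..n}. snd (X r)) r) / node_prod M r ((\<lambda>r\<in>{1..n}. snd (X r)) r) = w (X r)"
        using r by (simp add: w_def vX W)
    qed
    ultimately show "vdm {1..n} (\<lambda>r. x r * q ^ (\<lambda>r\<in>{1..n}. snd (X r)) r) *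
       (\<Prod>r=1..n. poly g (x r * q ^ (\<lambda>r\<in>{1..n}. snd (X r)) r) / node_prod M r ((\<lambda>r\<in>{1..n}. snd (X r)) r)) =
       vdm {1..n} (\<lambda>r. v (X r)) * (\<Prod>r\<in>{1..n}. w (X r))"
      by simp
  next
    fix k assume k: "k \<in> idx_box n M"
    show "(\<lambda>r\<in>{1..n}. snd ((\<lambda>r\<in>{1..n}. (r, k r)) r)) = k"
      using k by (intro extensionalityI[of _ "{1..n}"]) (auto simp: PiE_def)
    show "(\<lambda>r\<in>{1..n}. (r, k r)) \<in> Pi\<^sub>E {1..n} G"
      using k by (auto simp: G_def)
  qed
  finally show ?thesis .
qed

text \<open>The coefficient of the m-th value of f in the inner sum, without the denominators
  containing b.\<close>

definition inner_coeff :: "complex \<Rightarrow> (nat \<Rightarrow> nat) \<Rightarrow> (nat \<Rightarrow> nat) \<Rightarrow> complex" where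
  "inner_coeff \<alpha> k m = qkernel k m * q ^ (\<Sum>r=1..n. r * m r) *
     (\<Prod>r=1..n. qpoch q (\<alpha> * x r * q ^ msize n k) (m r))"

text \<open>The factor of the inner sum at a_r = q^(M_r + 1). There a_1 ... a_n / q^n = q^|M|,
  whence the power with exponent |M||k|.\<close>

definition outer_coeff :: "complex \<Rightarrow> (nat \<Rightarrow> nat) \<Rightarrow> (nat \<Rightarrow> nat) \<Rightarrow> complex" where
  "outer_coeff \<alpha> M k = qkernel M k * q ^ (msize n M * msize n k) * q ^ (\<Sum>r=1..n. (r - 1) * k r) *
     (\<Prod>r=1..n. (1 - \<alpha> * x r * q ^ (k r + msize n k)) / (1 - \<alpha> * x r) *
        (qpoch q (\<alpha> * x r) (msize n k) / qpoch q (\<alpha> * x r * q ^ Suc (M r)) (msize n k)))"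

definition outer_diag :: "complex \<Rightarrow> (nat \<Rightarrow> nat) \<Rightarrow> complex" where
  "outer_diag \<alpha> M = (\<Prod>r=1..n. qpoch q (\<alpha> * x r * q) (M r))"

lemma prod_prod_const_power: "(\<Prod>r=1..n. \<Prod>i<m r. c) = c ^ msize n m" for c :: complex
  by (simp add: msize_def power_sum)

text \<open>The kernel as a function of its first index: each factor q^(k_s |m|) clears the negative
  powers of q, leaving the value at x_s q^(k_s) of a polynomial of degree |m| that is the same for
  all s.\<close>

lemma qkernel_column:
  "qkernel k m * q ^ (msize n k * msize n m) =
     vandermonde_ratio n q x m / (\<Prod>r=1..n. \<Prod>s=1..n. qpoch q (q * x r / x s) (m r)) *
     (\<Prod>s=1..n. (1 / x s) ^ msize n m) * (\<Prod>s=1..n. \<Prod>r=1..n. \<Prod>i<m r. x s * q ^ k s - x r * q ^ i)"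
proof -
  have "q ^ (k s * msize n m) * (\<Prod>r=1..n. qpoch q (q powi (- int (k s)) * x r / x s) (m r)) =
      (1 / x s) ^ msize n m * (\<Prod>r=1..n. \<Prod>i<m r. x s * q ^ k s - x r * q ^ i)" if "s \<in> {1..n}" for s
  proof -
    have "q ^ (k s * msize n m) * (\<Prod>r=1..n. qpoch q (q powi (- int (k s)) * x r / x s) (m r)) =
        (\<Prod>r=1..n. \<Prod>i<m r. q ^ k s * (1 - q powi (- int (k s)) * x r / x s * q ^ i))"
      unfolding power_mult prod_prod_const_power[symmetric] qpoch_def prod.distrib ..
    also have "\<dots> = (\<Prod>r=1..n. \<Prod>i<m r. (1 / x s) * (x s * q ^ k s - x r * q ^ i))"
      by (intro prod.cong refl)
         (use q_nonzero x_nonzero[OF that] in \<open>simp add: powi_minus_nat field_simps\<close>)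
    also have "\<dots> = (1 / x s) ^ msize n m * (\<Prod>r=1..n. \<Prod>i<m r. x s * q ^ k s - x r * q ^ i)"
      unfolding prod_prod_const_power[symmetric] prod.distrib ..
    finally show ?thesis .
  qed
  then have "(\<Prod>s=1..n. q ^ (k s * msize n m)) *
      (\<Prod>s=1..n. \<Prod>r=1..n. qpoch q (q powi (- int (k s)) * x r / x s) (m r)) =
     (\<Prod>s=1..n. (1 / x s) ^ msize n m) * (\<Prod>s=1..n. \<Prod>r=1..n. \<Prod>i<m r. x s * q ^ k s - x r * q ^ i)"
    unfolding prod.distrib[symmetric] by (intro prod.cong refl)
  also have "(\<Prod>s=1..n. q ^ (k s * msize n m)) = q ^ (msize n k * msize n m)"
    unfolding power_sum[symmetric] msize_def sum_distrib_right ..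
  also have "(\<Prod>s=1..n. \<Prod>r=1..n. qpoch q (q powi (- int (k s)) * x r / x s) (m r)) =
      (\<Prod>r=1..n. \<Prod>s=1..n. qpoch q (q powi (- int (k s)) * x r / x s) (m r))"
    by (rule prod.swap)
  finally show ?thesis
    unfolding qkernel_def prod_dividef by (simp only: times_divide_eq_left times_divide_eq_right mult_ac)
qed

text \<open>As functions of \<open>k\<close>, the factors containing alpha combine to (alpha x_r
  q^(k_r + |m| + 1))_D, a polynomial of degree at most D in x_r q^(k_r). Together with the degree
  |m| from \<open>qkernel_column\<close> this gives |m| + D = |M| - 1, just below the bound of
  \<open>sum_idx_box_poly_eq_0\<close>.\<close>

lemma inner_outer_eq_0:
  assumes n: "n \<ge> 1" and less: "msize n m < msize n M"
    and generic: "\<And>r i. r \<in> {1..n} \<Longrightarrow> 1 - \<alpha> * x r * q ^ i \<noteq> 0"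
  shows "(\<Sum>k\<in>idx_box n M. inner_coeff \<alpha> M k * (outer_coeff \<alpha> k m / outer_diag \<alpha> k)) = 0"
proof -
  define D where "D = msize n M - msize n m - 1"
  define g where "g = (\<Prod>r=1..n. \<Prod>i<m r. [:- (x r * q ^ i), 1:]) * (\<Prod>i<D. [:1, - (\<alpha> * q ^ (msize n m + 1) * q ^ i):])"
  have nz: "qpoch q (\<alpha> * x r * q ^ i) j \<noteq> 0" if "r \<in> {1..n}" for r i j
    using generic[OF that] by (auto simp: qpoch_def mult.assoc simp flip: power_add)
  have "degree (\<Prod>r=1..n. \<Prod>i<m r. [:- (x r * q ^ i), 1:]) = msize n m"
    by (simp add: degree_prod_eq_sum_degree msize_def)
  moreover have "degree (\<Prod>i<D. [:1, - (\<alpha> * q ^ (msize n m + 1) * q ^ i):]) \<le> D"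
  proof -
    have "degree (\<Prod>i<D. [:1, - (\<alpha> * q ^ (msize n m + 1) * q ^ i):]) \<le>
        (\<Sum>i<D. degree [:1, - (\<alpha> * q ^ (msize n m + 1) * q ^ i):])"
      by (rule order_trans[OF degree_prod_sum_le]) (simp_all only: o_def finite_lessThan order_refl)
    also have "\<dots> \<le> (\<Sum>i<D. 1)"
      by (intro sum_mono) simp
    finally show ?thesis by simp
  qed
  ultimately have "degree g \<le> msize n m + D"
    unfolding g_def by (intro order_trans[OF degree_mult_le] add_mono) simp_all
  then have deg: "degree g < msize n M"
    using less by (simp add: D_def)
  have poly_g: "poly g z = (\<Prod>r=1..n. \<Prod>i<m r. z - x r * q ^ i) * qpoch q (\<alpha> * z * q ^ (msize n m + 1)) D" for z
    by (simp add: g_def poly_prod qpoch_def mult_ac)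
  define A where "A = (\<Prod>r=1..n. (1 - \<alpha> * x r * q ^ (m r + msize n m)) / (1 - \<alpha> * x r) * qpoch q (\<alpha> * x r) (msize n m))"
  define B where "B = (\<Prod>r=1..n. qpoch q (\<alpha> * x r * q) (msize n M - 1))"
  define C where "C = (\<Prod>r=1..n. node_prod M r 0) / vdm {1..n} x *
     (vandermonde_ratio n q x m / (\<Prod>r=1..n. \<Prod>s=1..n. qpoch q (q * x r / x s) (m r)) *
     (\<Prod>s=1..n. (1 / x s) ^ msize n m)) * q ^ (\<Sum>r=1..n. (r - 1) * m r) * (A / B)"
  have "inner_coeff \<alpha> M k * (outer_coeff \<alpha> k m / outer_diag \<alpha> k) =
      C * (vdm {1..n} (\<lambda>r. x r * q ^ k r) * (\<Prod>r=1..n. poly g (x r * q ^ k r) / node_prod M r (k r)))"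
    if k: "k \<in> idx_box n M" for k
  proof -
    have alpha: "(\<Prod>r=1..n. qpoch q (\<alpha> * x r * q ^ msize n M) (k r)) * 
        ((\<Prod>r=1..n. (1 - \<alpha> * x r * q ^ (m r + msize n m)) / (1 - \<alpha> * x r) *
          (qpoch q (\<alpha> * x r) (msize n m) / qpoch q (\<alpha> * x r * q ^ Suc (k r)) (msize n m))) / outer_diag \<alpha> k) =
       A / B * (\<Prod>r=1..n. qpoch q (\<alpha> * (x r * q ^ k r) * q ^ (msize n m + 1)) D)"
      unfolding A_def B_def outer_diag_def prod_dividef[symmetric] prod.distrib[symmetric]
    proof (intro prod.cong refl)
      fix r assume r: "r \<in> {1..n}"
      \<comment> \<open>One shifted factorial of length k_r + |M| - 1, cut in two ways; the pieces
        are all the factors that contain alpha and depend on k.\<close>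
      have "qpoch q (\<alpha> * x r * q) (k r + (msize n m + D)) = qpoch q (\<alpha> * x r * q) ((msize n M - 1) + k r)"
        using less by (simp add: D_def add.commute)
      note eq = this
      have *: "qpoch q (\<alpha> * x r * q) (k r) * (qpoch q (\<alpha> * x r * q ^ Suc (k r)) (msize n m) *
          qpoch q (\<alpha> * (x r * q ^ k r) * q ^ (msize n m + 1)) D) =
         qpoch q (\<alpha> * x r * q) (msize n M - 1) * qpoch q (\<alpha> * x r * q ^ msize n M) (k r)"
      proof -
        have "\<alpha> * x r * q ^ Suc (k r) = \<alpha> * x r * q * q ^ k r"
          "\<alpha> * (x r * q ^ k r) * q ^ (msize n m + 1) = \<alpha> * x r * q * q ^ k r * q ^ msize n m"
          by (simp_all add: mult_ac)
        moreover have "\<alpha> * x r * q ^ msize n M = \<alpha> * x r * q * q ^ (msize n M - 1)"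
          using less power_minus_mult[of "msize n M" q] by (simp add: mult_ac)
        ultimately show ?thesis
          using eq by (simp only: qpoch_add)
      qed
      show "qpoch q (\<alpha> * x r * q ^ msize n M) (k r) * ((1 - \<alpha> * x r * q ^ (m r + msize n m)) / (1 - \<alpha> * x r) *
          (qpoch q (\<alpha> * x r) (msize n m) / qpoch q (\<alpha> * x r * q ^ Suc (k r)) (msize n m)) / qpoch q (\<alpha> * x r * q) (k r)) =
         (1 - \<alpha> * x r * q ^ (m r + msize n m)) / (1 - \<alpha> * x r) * qpoch q (\<alpha> * x r) (msize n m) /
         qpoch q (\<alpha> * x r * q) (msize n M - 1) * qpoch q (\<alpha> * (x r * q ^ k r) * q ^ (msize n m + 1)) D"
        using nz[OF r, of 1 "k r"] nz[OF r, of 1 "msize n M - 1"] nz[OF r, of "Suc (k r)" "msize n m"]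
        unfolding power_one_right by (intro mult_divide_cancel_swap *)
    qed
    have nodes: "qkernel M k * q ^ (\<Sum>r=1..n. r * k r) =
     (\<Prod>r=1..n. node_prod M r 0) / vdm {1..n} x *
     (vdm {1..n} (\<lambda>r. x r * q ^ k r) / (\<Prod>r=1..n. node_prod M r (k r)))"
      using k by (intro qkernel_nodes) auto
    have "inner_coeff \<alpha> M k * (outer_coeff \<alpha> k m / outer_diag \<alpha> k) =
       (qkernel M k * q ^ (\<Sum>r=1..n. r * k r)) *
       (qkernel k m * q ^ (msize n k * msize n m)) * q ^ (\<Sum>r=1..n. (r - 1) * m r) *
       ((\<Prod>r=1..n. qpoch q (\<alpha> * x r * q ^ msize n M) (k r)) *
        ((\<Prod>r=1..n. (1 - \<alpha> * x r * q ^ (m r + msize n m)) / (1 - \<alpha> * x r) *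
          (qpoch q (\<alpha> * x r) (msize n m) / qpoch q (\<alpha> * x r * q ^ Suc (k r)) (msize n m))) / outer_diag \<alpha> k))"
      unfolding inner_coeff_def outer_coeff_def by (simp only: mult_ac divide_inverse)
    note fac = this[unfolded alpha nodes qkernel_column]
    show ?thesis
      unfolding fac C_def poly_g prod_dividef prod.distrib by (simp only: divide_inverse mult_ac)
  qed
  then have "(\<Sum>k\<in>idx_box n M. inner_coeff \<alpha> M k * (outer_coeff \<alpha> k m / outer_diag \<alpha> k)) =
    C * (\<Sum>k\<in>idx_box n M. vdm {1..n} (\<lambda>r. x r * q ^ k r) * (\<Prod>r=1..n. poly g (x r * q ^ k r) / node_prod M r (k r)))"
    by (simp add: sum_distrib_left)
  then show ?thesis
    using sum_idx_box_poly_eq_0[OF deg n] by simp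
qed

lemma inner_outer_diag:
  assumes generic: "\<And>r i. r \<in> {1..n} \<Longrightarrow> 1 - \<alpha> * x r * q ^ i \<noteq> 0"
  shows "inner_coeff \<alpha> M M * (outer_coeff \<alpha> M M / outer_diag \<alpha> M) = 1"
proof -
  have nz: "qpoch q (\<alpha> * x r * q ^ i) j \<noteq> 0" if "r \<in> {1..n}" for r i j
    using generic[OF that] by (auto simp: qpoch_def mult.assoc simp flip: power_add)
  let ?m = "msize n M"
  have "(\<Prod>r=1..n. qpoch q (\<alpha> * x r * q ^ ?m) (M r)) * ((\<Prod>r=1..n. (1 - \<alpha> * x r * q ^ (M r + ?m)) / (1 - \<alpha> * x r) *
        (qpoch q (\<alpha> * x r) ?m / qpoch q (\<alpha> * x r * q ^ Suc (M r)) ?m)) / outer_diag \<alpha> M) = 1"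
    unfolding outer_diag_def prod_dividef[symmetric] prod.distrib[symmetric]
  proof (intro prod.neutral ballI)
    fix r assume r: "r \<in> {1..n}"
    have e1: "\<alpha> * x r * q ^ Suc (M r) = \<alpha> * x r * q ^ 1 * q ^ M r"
      by (simp add: mult_ac)
    \<comment> \<open>Cutting this one factorial after |M| factors, or after 1 and then M_r factors,
      produces the numerator and the denominator.\<close>
    have "qpoch q (\<alpha> * x r) (Suc (?m + M r)) = qpoch q (\<alpha> * x r) (1 + (M r + ?m))"
      by (simp add: add.commute)
    then have *: "qpoch q (\<alpha> * x r) ?m * qpoch q (\<alpha> * x r * q ^ ?m) (M r) * (1 - \<alpha> * x r * q ^ (M r + ?m)) =
       (1 - \<alpha> * x r) * (qpoch q (\<alpha> * x r * q) (M r) * qpoch q (\<alpha> * x r * q ^ Suc (M r)) ?m)"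
      unfolding e1 qpoch_add qpoch_Suc by (simp add: qpoch_Suc mult_ac add.commute)
    have "qpoch q (\<alpha> * x r * q ^ ?m) (M r) * ((1 - \<alpha> * x r * q ^ (M r + ?m)) / (1 - \<alpha> * x r) *
        (qpoch q (\<alpha> * x r) ?m / qpoch q (\<alpha> * x r * q ^ Suc (M r)) ?m) / qpoch q (\<alpha> * x r * q) (M r)) =
      (qpoch q (\<alpha> * x r) ?m * qpoch q (\<alpha> * x r * q ^ ?m) (M r) * (1 - \<alpha> * x r * q ^ (M r + ?m))) /
       ((1 - \<alpha> * x r) * (qpoch q (\<alpha> * x r * q) (M r) * qpoch q (\<alpha> * x r * q ^ Suc (M r)) ?m))"
      by (simp only: divide_inverse inverse_mult_distrib mult_ac)
    then show "qpoch q (\<alpha> * x r * q ^ ?m) (M r) * ((1 - \<alpha> * x r * q ^ (M r + ?m)) / (1 - \<alpha> * x r) *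
        (qpoch q (\<alpha> * x r) ?m / qpoch q (\<alpha> * x r * q ^ Suc (M r)) ?m) / qpoch q (\<alpha> * x r * q) (M r)) = 1"
      unfolding * using nz[OF r, of 1 "M r"] nz[OF r, of "Suc (M r)" ?m] generic[OF r, of 0] by simp
  qed
  moreover have "inner_coeff \<alpha> M M * (outer_coeff \<alpha> M M / outer_diag \<alpha> M) =
     ((qkernel M M)\<^sup>2 * q ^ (?m * ?m + (\<Sum>r=1..n. r * M r) + (\<Sum>r=1..n. (r - 1) * M r))) *
     ((\<Prod>r=1..n. qpoch q (\<alpha> * x r * q ^ ?m) (M r)) * ((\<Prod>r=1..n. (1 - \<alpha> * x r * q ^ (M r + ?m)) / (1 - \<alpha> * x r) *
        (qpoch q (\<alpha> * x r) ?m / qpoch q (\<alpha> * x r * q ^ Suc (M r)) ?m)) / outer_diag \<alpha> M))"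
    unfolding inner_coeff_def outer_coeff_def power_add power2_eq_square
    by (simp only: mult_ac divide_inverse)
  ultimately show ?thesis
    by (simp only: qkernel_diagonal mult_1)
qed

lemma inner_coeff_eq_0: "r \<in> {1..n} \<Longrightarrow> M r < k r \<Longrightarrow> inner_coeff \<alpha> M k = 0"
  by (simp add: inner_coeff_def qkernel_eq_0)

lemma outer_coeff_eq_0: "r \<in> {1..n} \<Longrightarrow> M r < k r \<Longrightarrow> outer_coeff \<alpha> M k = 0"
  by (simp add: outer_coeff_def qkernel_eq_0)

text \<open>The row index varies over a fixed box, as the inversion of a square matrix requires;
  triangularity reduces the sum to the box below \<open>M\<close>, where either the diagonal or the
  vanishing result applies, or every term is 0.\<close>

lemma inner_outer:
  assumes n: "n \<ge> 1" and box: "M \<in> idx_box n N" "m \<in> idx_box n N"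
    and generic: "\<And>r i. r \<in> {1..n} \<Longrightarrow> 1 - \<alpha> * x r * q ^ i \<noteq> 0"
  shows "(\<Sum>k\<in>idx_box n N. inner_coeff \<alpha> M k * (outer_coeff \<alpha> k m / outer_diag \<alpha> k)) = (if M = m then 1 else 0)"
proof -
  have "idx_box n M \<subseteq> idx_box n N"
    using box idx_box_trans by blast
  moreover have "\<exists>r\<in>{1..n}. M r < k r" if "k \<in> idx_box n N - idx_box n M" for k
    using that by (blast elim: not_in_idx_boxE)
  ultimately have *: "(\<Sum>k\<in>idx_box n N. inner_coeff \<alpha> M k * (outer_coeff \<alpha> k m / outer_diag \<alpha> k)) =
      (\<Sum>k\<in>idx_box n M. inner_coeff \<alpha> M k * (outer_coeff \<alpha> k m / outer_diag \<alpha> k))"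
    by (intro sum.mono_neutral_right finite_idx_box) (use inner_coeff_eq_0 in \<open>blast intro: mult_eq_0_iff[THEN iffD2]\<close>)+
  have out: "outer_coeff \<alpha> k m = 0" if "m \<notin> idx_box n k" for k
  proof -
    have "\<exists>r\<in>{1..n}. k r < m r"
      using that box(2) by (blast elim: not_in_idx_boxE)
    then show ?thesis using outer_coeff_eq_0 by blast
  qed
  show ?thesis
  proof (cases "m \<in> idx_box n M")
    case True
    show ?thesis
    proof (cases "M = m")
      case True
      have "k = M" if "k \<in> idx_box n M" "M \<in> idx_box n k" for k
        using idx_box_msize_less[OF that(1) that(2)] idx_box_msize_less[OF that(2) that(1)] by fastforce
      then have zero: "outer_coeff \<alpha> k m = 0" if "k \<in> idx_box n M - {M}" for k
        using that True out by blast
      have "(\<Sum>k\<in>idx_box n M. inner_coeff \<alpha> M k * (outer_coeff \<alpha> k m / outer_diag \<alpha> k)) =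
          (\<Sum>k\<in>{M}. inner_coeff \<alpha> M k * (outer_coeff \<alpha> k m / outer_diag \<alpha> k))"
      proof (rule sum.mono_neutral_right[OF finite_idx_box])
        show "{M} \<subseteq> idx_box n M"
          using True \<open>m \<in> idx_box n M\<close> by simp
        show "\<forall>k\<in>idx_box n M - {M}. inner_coeff \<alpha> M k * (outer_coeff \<alpha> k m / outer_diag \<alpha> k) = 0"
          using zero by auto
      qed
      then show ?thesis
        using True inner_outer_diag[OF generic] unfolding * by simp
    next
      case False
      then have "msize n m < msize n M"
        using idx_box_msize_less[OF True box(1)] by auto
      then show ?thesis
        using False inner_outer_eq_0[OF n _ generic] unfolding * by simp
    qed
  next
    case False
    have "m \<notin> idx_box n k" if "k \<in> idx_box n M" for k
      using False that idx_box_trans by blast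
    then have "(\<Sum>k\<in>idx_box n M. inner_coeff \<alpha> M k * (outer_coeff \<alpha> k m / outer_diag \<alpha> k)) = 0"
      by (intro sum.neutral) (auto simp: out)
    moreover have "M \<noteq> m"
      using False box(1) by (auto simp: mem_idx_box_iff)
    ultimately show ?thesis
      unfolding * by simp
  qed
qed

lemma outer_inner_generic:
  assumes n: "n \<ge> 1" and M: "M \<in> idx_box n M" and m: "m \<in> idx_box n M"
    and generic: "\<And>r i. r \<in> {1..n} \<Longrightarrow> 1 - \<alpha> * x r * q ^ i \<noteq> 0"
  shows "(\<Sum>k\<in>idx_box n M. outer_coeff \<alpha> M k * inner_coeff \<alpha> k m) = (if M = m then outer_diag \<alpha> M else 0)"
proof -
  have nz: "outer_diag \<alpha> M \<noteq> 0"
    using generic by (auto simp: outer_diag_def qpoch_def mult.assoc simp flip: power_Suc)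
  have "(\<Sum>k\<in>idx_box n M. outer_coeff \<alpha> M k / outer_diag \<alpha> M * inner_coeff \<alpha> k m) = (if M = m then 1 else 0)"
  proof (rule triangular_inverse_commute[where \<mu> = "msize n" and B = "\<lambda>k m. outer_coeff \<alpha> k m / outer_diag \<alpha> k"])
    fix i k assume ik: "i \<in> idx_box n M" "k \<in> idx_box n M" "k \<noteq> i" "inner_coeff \<alpha> i k \<noteq> 0"
    then have "k \<in> idx_box n i"
      using inner_coeff_eq_0 not_in_idx_boxE by metis
    then show "msize n k < msize n i"
      using ik idx_box_msize_less by blast
  next
    fix i assume "i \<in> idx_box n M"
    show "inner_coeff \<alpha> i i \<noteq> 0"
      using inner_outer_diag[OF generic, of i] by auto
  next
    fix i j assume "i \<in> idx_box n M" "j \<in> idx_box n M"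
    then show "(\<Sum>k\<in>idx_box n M. inner_coeff \<alpha> i k * (outer_coeff \<alpha> k j / outer_diag \<alpha> k)) = (if i = j then 1 else 0)"
      using inner_outer[OF n _ _ generic] by blast
  qed (fact finite_idx_box M m)+
  then have "(\<Sum>k\<in>idx_box n M. outer_coeff \<alpha> M k * inner_coeff \<alpha> k m) / outer_diag \<alpha> M = (if M = m then 1 else 0)"
    by (simp add: sum_divide_distrib)
  then show ?thesis
    using nz by (simp add: divide_simps split: if_splits)
qed

lemma isCont_qpoch: "isCont (\<lambda>\<alpha>. qpoch q (\<alpha> * c) k) \<alpha>"
  unfolding qpoch_def by (intro continuous_intros)

text \<open>Free of division by \<open>outer_diag\<close>, the identity has only the denominators
  listed in the hypotheses, so both sides are continuous at \<alpha>. Were they different there,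
  they would differ on a ball; but the non-generic parameters are countable, and a ball is
  not.\<close>

lemma outer_inner:
  assumes n: "n \<ge> 1" and M: "M \<in> idx_box n M" and m: "m \<in> idx_box n M"
    and nz: "\<And>r. r \<in> {1..n} \<Longrightarrow> 1 - \<alpha> * x r \<noteq> 0"
      "\<And>r k. r \<in> {1..n} \<Longrightarrow> qpoch q (\<alpha> * x r * q ^ Suc (M r)) k \<noteq> 0"
  shows "(\<Sum>k\<in>idx_box n M. outer_coeff \<alpha> M k * inner_coeff \<alpha> k m) = (if M = m then outer_diag \<alpha> M else 0)"
proof (rule ccontr)
  define F where "F \<alpha> = (\<Sum>k\<in>idx_box n M. outer_coeff \<alpha> M k * inner_coeff \<alpha> k m) - (if M = m then outer_diag \<alpha> M else 0)" for \<alpha>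
  assume "\<not> ?thesis"
  then have F0: "F \<alpha> \<noteq> 0"
    by (simp add: F_def)
  have "isCont (\<lambda>\<alpha>. outer_coeff \<alpha> M k) \<alpha>" for k
    unfolding outer_coeff_def mult.assoc using nz
    by (intro continuous_intros isCont_qpoch) (auto simp: mult.assoc)
  moreover have "isCont (\<lambda>\<alpha>. inner_coeff \<alpha> k m) \<alpha>" for k
    unfolding inner_coeff_def mult.assoc by (intro continuous_intros isCont_qpoch)
  moreover have "isCont (\<lambda>\<alpha>. outer_diag \<alpha> M) \<alpha>"
    unfolding outer_diag_def mult.assoc by (intro continuous_intros isCont_qpoch)
  ultimately have "isCont F \<alpha>"
    unfolding F_def by (cases "M = m") (auto intro!: continuous_intros)
  then have "eventually (\<lambda>\<beta>. F \<beta> \<noteq> 0) (nhds \<alpha>)"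
    using F0 by (simp add: isCont_def tendsto_imp_eventually_ne eventually_nhds_conv_at)
  then obtain e where e: "e > 0" "\<And>\<beta>. dist \<beta> \<alpha> < e \<Longrightarrow> F \<beta> \<noteq> 0"
    by (auto simp: eventually_nhds_metric)
  have "countable (\<Union>r\<in>{1..n}. \<Union>i. {1 / (x r * q ^ i)})"
    by simp
  then obtain \<beta> where \<beta>: "\<beta> \<in> ball \<alpha> e" "\<beta> \<notin> (\<Union>r\<in>{1..n}. \<Union>i. {1 / (x r * q ^ i)})"
    using uncountable_ball[OF e(1), of \<alpha>] by (metis countable_subset subsetI)
  have "1 - \<beta> * x r * q ^ i \<noteq> 0" if "r \<in> {1..n}" for r i
  proof
    assume "1 - \<beta> * x r * q ^ i = 0"
    then have "\<beta> = 1 / (x r * q ^ i)"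
      using x_nonzero[OF that] q_nonzero by (simp add: field_simps)
    then show False
      using \<beta>(2) that by blast
  qed
  from outer_inner_generic[OF n M m this] have "F \<beta> = 0"
    by (simp add: F_def)
  then show False
    using e(2)[of \<beta>] \<beta>(1) by (simp add: dist_commute)
qed

end

section \<open>The terminating identity\<close>

lemma abs_convergent_prod_qpoch_inf:
  fixes q z :: complex
  assumes "norm q < 1"
  shows "abs_convergent_prod (\<lambda>i. 1 - z * q ^ i)"
  using assms by (intro summable_imp_abs_convergent_prod)
    (simp add: norm_mult norm_power summable_mult summable_geometric)

lemma qpoch_inf_split:
  assumes "norm q < 1"
  shows "qpoch_inf q z = qpoch q z k * qpoch_inf q (z * q ^ k)"
proof (rule LIMSEQ_unique)
  have lim: "(\<lambda>n. \<Prod>i\<le>n. 1 - z * q ^ i) \<longlonglongrightarrow> qpoch_inf q z" for z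
    unfolding qpoch_inf_def using assms
    by (intro convergent_prod_LIMSEQ abs_convergent_prod_imp_convergent_prod abs_convergent_prod_qpoch_inf)
  have "(\<Prod>i\<le>n + k. 1 - z * q ^ i) = qpoch q z k * (\<Prod>i\<le>n. 1 - z * q ^ k * q ^ i)" for n
    using qpoch_add[of q z k "Suc n"]
    by (simp add: qpoch_def add.commute flip: lessThan_Suc_atMost)
  moreover have "(\<lambda>n. qpoch q z k * (\<Prod>i\<le>n. 1 - z * q ^ k * q ^ i)) \<longlonglongrightarrow> qpoch q z k * qpoch_inf q (z * q ^ k)"
    by (intro tendsto_intros lim)
  ultimately show "(\<lambda>n. \<Prod>i\<le>n + k. 1 - z * q ^ i) \<longlonglongrightarrow> qpoch q z k * qpoch_inf q (z * q ^ k)"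
    by simp
  show "(\<lambda>n. \<Prod>i\<le>n + k. 1 - z * q ^ i) \<longlonglongrightarrow> qpoch_inf q z"
    by (intro LIMSEQ_ignore_initial_segment lim)
qed

lemma one_minus_mult_power_nonzero:
  fixes q z :: complex
  assumes "norm q < 1" "norm z < 1"
  shows "1 - z * q ^ i \<noteq> 0"
proof -
  have "norm (z * q ^ i) \<le> norm z * 1"
    unfolding norm_mult norm_power using assms by (intro mult_left_mono power_le_one) auto
  then show ?thesis
    using assms by auto
qed

lemma qpoch_inf_nonzero:
  assumes "norm q < 1" "norm z < 1"
  shows "qpoch_inf q z \<noteq> 0"
  unfolding qpoch_inf_def using assms
  by (intro prodinf_nonzero abs_convergent_prod_imp_convergent_prod abs_convergent_prod_qpoch_inf
      one_minus_mult_power_nonzero)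

lemma qpoch_nonzero:
  assumes "norm q < 1" "norm z < 1"
  shows "qpoch q z k \<noteq> 0"
  unfolding qpoch_def using one_minus_mult_power_nonzero[OF assms] by simp

lemma terminating_identity:
  fixes n :: nat and q \<alpha> b :: complex and x a :: "nat \<Rightarrow> complex" and N :: "nat \<Rightarrow> nat"
  assumes q: "0 < norm q" "norm q < 1" and n: "n \<ge> 1"
    and den: "denominators_nonzero n q \<alpha> b x a"
    and N: "\<And>r. r \<in> {1..n} \<Longrightarrow> N r > 0 \<and> a r = q ^ N r"
  shows "((\<lambda>k. identity_term n q \<alpha> b x f a k) has_sum identity_lhs n q \<alpha> b x f a) (multi_indices n)"
proof -
  interpret qnodes n q x
  proof
    show "q \<noteq> 0"
      using q by auto
    fix r assume r: "r \<in> {1..n}"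
    show "x r \<noteq> 0"
      using den r unfolding denominators_nonzero_def by blast
    fix s assume s: "s \<in> {1..n}"
    show "qpoch q (q * x r / x s) k \<noteq> 0" for k
      using den r s unfolding denominators_nonzero_def by blast
    assume "r < s"
    then have "x s \<noteq> 0" "1 - x r / x s \<noteq> 0"
      using den r s unfolding denominators_nonzero_def by blast+
    then show "x r \<noteq> x s"
      by auto
  qed
  \<comment> \<open>The shift by one makes alpha a_r = alpha q^(1 + M_r), the argument of f in the
    inner sum at m = M. It is possible because the exponents are positive.\<close>
  define M where "M = (\<lambda>r\<in>{1..n}. N r - 1)"
  have M_box: "M \<in> idx_box n M"
    by (auto simp: M_def)
  have a: "a r = q ^ Suc (M r)" if "r \<in> {1..n}" for r
    using N[OF that] that by (simp add: M_def flip: power_Suc)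
  \<comment> \<open>All dependence on f and b is collected here; it involves only \<open>m\<close>,
    so the sum over \<open>k\<close> can be carried out first.\<close>
  define F where "F m = f (\<lambda>r\<in>{1..n}. \<alpha> * q ^ (1 + m r)) / (\<Prod>r=1..n. qpoch q (\<alpha> * b * x r) (m r))" for m
  have inner: "inner_sum n q \<alpha> b x f k = (\<Sum>m\<in>idx_box n k. inner_coeff \<alpha> k m * F m)" for k
    unfolding inner_sum_def inner_coeff_def qkernel_def F_def prod_dividef
    by (intro sum.cong refl) (simp only: divide_inverse mult_ac)
  have shifted: "shifted_numerator n q x a k =
      (\<Prod>r=1..n. \<Prod>s=1..n. qpoch q (q powi (- int (M s)) * x r / x s) (k r)) * q ^ (msize n M * msize n k) * (q ^ n) ^ msize n k" for k
  proof -
    have "shifted_numerator n q x a k =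
       (\<Prod>r=1..n. \<Prod>s=1..n. \<Prod>i<k r. q ^ Suc (M s) * (1 - q powi (- int (M s)) * x r / x s * q ^ i))"
      unfolding shifted_numerator_def
      by (intro prod.cong refl) (use q in \<open>simp add: a powi_minus_nat field_simps del: atLeastAtMost_iff One_nat_def\<close>)
    also have "\<dots> = (\<Prod>r=1..n. \<Prod>s=1..n. qpoch q (q powi (- int (M s)) * x r / x s) (k r)) *
        (\<Prod>r=1..n. \<Prod>s=1..n. q ^ (Suc (M s) * k r))"
      unfolding qpoch_def prod.distrib prod_constant card_lessThan power_mult by (rule mult.commute)
    also have "(\<Prod>r=1..n. \<Prod>s=1..n. q ^ (Suc (M s) * k r)) = q ^ ((\<Sum>s=1..n. Suc (M s)) * msize n k)"
      unfolding power_sum[symmetric] msize_def sum_distrib_right[symmetric] sum_distrib_left[symmetric] ..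
    also have "(\<Sum>s=1..n. Suc (M s)) = msize n M + n"
      unfolding Suc_eq_plus1 sum.distrib msize_def by simp
    finally show ?thesis
      by (simp only: distrib_right power_add power_mult mult.assoc)
  qed
  have nz1: "1 - \<alpha> * x r \<noteq> 0" and nz2: "qpoch q (\<alpha> * x r * q ^ Suc (M r)) k \<noteq> 0"
    if "r \<in> {1..n}" for r k
    using den that unfolding denominators_nonzero_def a[OF that, symmetric] by blast+
  have *: "identity_term n q \<alpha> b x f a k = outer_coeff \<alpha> M k * inner_sum n q \<alpha> b x f k" for k
  proof -
    have e1: "(\<Prod>r=1..n. (1 - \<alpha> * x r * q ^ (k r + msize n k)) / (1 - \<alpha> * x r)) *
       (\<Prod>r=1..n. qpoch q (\<alpha> * x r) (msize n k) / qpoch q (\<alpha> * x r * a r) (msize n k)) =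
      (\<Prod>r=1..n. (1 - \<alpha> * x r * q ^ (k r + msize n k)) / (1 - \<alpha> * x r) *
        (qpoch q (\<alpha> * x r) (msize n k) / qpoch q (\<alpha> * x r * q ^ Suc (M r)) (msize n k)))"
      unfolding prod.distrib[symmetric] by (intro prod.cong refl) (simp only: a)
    have e2: "(q ^ n) ^ msize n k * (1 / q ^ n) ^ msize n k = 1"
      using q_nonzero by (simp flip: power_mult_distrib)
    have "identity_term n q \<alpha> b x f a k = (vandermonde_ratio n q x k *
       ((\<Prod>r=1..n. \<Prod>s=1..n. qpoch q (q powi (- int (M s)) * x r / x s) (k r)) /
        (\<Prod>r=1..n. \<Prod>s=1..n. qpoch q (q * x r / x s) (k r)))) * q ^ (msize n M * msize n k) *
       ((q ^ n) ^ msize n k * (1 / q ^ n) ^ msize n k) * q ^ (\<Sum>r=1..n. (r - 1) * k r) *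
      ((\<Prod>r=1..n. (1 - \<alpha> * x r * q ^ (k r + msize n k)) / (1 - \<alpha> * x r)) *
       (\<Prod>r=1..n. qpoch q (\<alpha> * x r) (msize n k) / qpoch q (\<alpha> * x r * a r) (msize n k))) *
      inner_sum n q \<alpha> b x f k"
      unfolding identity_term_def shifted by (simp only: divide_inverse mult_ac)
    note eq = this[unfolded e1 e2 mult_1_right]
    have "(\<Prod>r=1..n. \<Prod>s=1..n. qpoch q (q powi (- int (M s)) * x r / x s) (k r) / qpoch q (q * x r / x s) (k r)) =
       (\<Prod>r=1..n. \<Prod>s=1..n. qpoch q (q powi (- int (M s)) * x r / x s) (k r)) /
        (\<Prod>r=1..n. \<Prod>s=1..n. qpoch q (q * x r / x s) (k r))"
      by (simp only: prod_dividef)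
    then show ?thesis
      by (simp only: eq outer_coeff_def qkernel_def)
  qed
  have "(\<Sum>k\<in>idx_box n M. identity_term n q \<alpha> b x f a k) =
      (\<Sum>k\<in>idx_box n M. \<Sum>m\<in>idx_box n k. outer_coeff \<alpha> M k * inner_coeff \<alpha> k m * F m)"
    unfolding * inner sum_distrib_left mult.assoc ..
  \<comment> \<open>The inner coefficients vanish outside the box of \<open>k\<close>, so
    \<open>m\<close> may range over a box independent of \<open>k\<close> and the sums can be
    exchanged.\<close>
  also have "\<dots> = (\<Sum>k\<in>idx_box n M. \<Sum>m\<in>idx_box n M. outer_coeff \<alpha> M k * inner_coeff \<alpha> k m * F m)"
  proof (rule sum.cong[OF refl])
    fix k assume k: "k \<in> idx_box n M"
    show "(\<Sum>m\<in>idx_box n k. outer_coeff \<alpha> M k * inner_coeff \<alpha> k m * F m) =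
        (\<Sum>m\<in>idx_box n M. outer_coeff \<alpha> M k * inner_coeff \<alpha> k m * F m)"
    proof (rule sum.mono_neutral_left[OF finite_idx_box], goal_cases)
      case 1
      then show ?case
        using k idx_box_trans by blast
    next
      case 2
      have "inner_coeff \<alpha> k m = 0" if "m \<in> idx_box n M - idx_box n k" for m
        using that inner_coeff_eq_0 by (blast elim: not_in_idx_boxE)
      then show ?case
        by simp
    qed
  qed
  also have "\<dots> = (\<Sum>m\<in>idx_box n M. (\<Sum>k\<in>idx_box n M. outer_coeff \<alpha> M k * inner_coeff \<alpha> k m) * F m)"
    by (subst sum.swap) (simp add: sum_distrib_right)
  also have "\<dots> = (\<Sum>m\<in>idx_box n M. if M = m then outer_diag \<alpha> M * F M else 0)"
  proof (intro sum.cong refl)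
    fix m assume m: "m \<in> idx_box n M"
    have "(\<Sum>k\<in>idx_box n M. outer_coeff \<alpha> M k * inner_coeff \<alpha> k m) = (if M = m then outer_diag \<alpha> M else 0)"
      by (intro outer_inner n M_box m nz1 nz2)
    then show "(\<Sum>k\<in>idx_box n M. outer_coeff \<alpha> M k * inner_coeff \<alpha> k m) * F m =
        (if M = m then outer_diag \<alpha> M * F M else 0)"
      by simp
  qed
  also have "\<dots> = outer_diag \<alpha> M * F M"
    unfolding sum.delta'[OF finite_idx_box] using M_box by (rule if_P)
  also have "\<dots> = identity_lhs n q \<alpha> b x f a"
  proof -
    \<comment> \<open>Since a_r / q = q^(M_r), each of the two quotients of infinite products leaves
      a finite product of length M_r.\<close>
    have "(qpoch_inf q (\<alpha> * q * x r) * qpoch_inf q (\<alpha> * a r * b * x r / q)) /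
        (qpoch_inf q (\<alpha> * b * x r) * qpoch_inf q (\<alpha> * x r * a r)) =
      qpoch q (\<alpha> * x r * q) (M r) / qpoch q (\<alpha> * b * x r) (M r)" if r: "r \<in> {1..n}" for r
    proof -
      have nz: "qpoch_inf q (\<alpha> * x r * a r) \<noteq> 0" "qpoch_inf q (\<alpha> * b * x r) \<noteq> 0"
        using den r unfolding denominators_nonzero_def by blast+
      have eqs: "\<alpha> * x r * q * q ^ M r = \<alpha> * x r * a r"
        "\<alpha> * b * x r * q ^ M r = \<alpha> * a r * b * x r / q" "\<alpha> * q * x r = \<alpha> * x r * q"
        using a[OF r] q by auto
      have "qpoch_inf q (\<alpha> * x r * q) = qpoch q (\<alpha> * x r * q) (M r) * qpoch_inf q (\<alpha> * x r * a r)"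
        using qpoch_inf_split[OF q(2), of "\<alpha> * x r * q" "M r"] by (simp only: eqs)
      moreover have "qpoch_inf q (\<alpha> * b * x r) =
          qpoch q (\<alpha> * b * x r) (M r) * qpoch_inf q (\<alpha> * a r * b * x r / q)"
        using qpoch_inf_split[OF q(2), of "\<alpha> * b * x r" "M r"] by (simp only: eqs)
      ultimately show ?thesis
        using nz unfolding eqs(3) by simp
    qed
    then have rat: "(\<Prod>r=1..n. (qpoch_inf q (\<alpha> * q * x r) * qpoch_inf q (\<alpha> * a r * b * x r / q)) /
        (qpoch_inf q (\<alpha> * b * x r) * qpoch_inf q (\<alpha> * x r * a r))) =
      (\<Prod>r=1..n. qpoch q (\<alpha> * x r * q) (M r) / qpoch q (\<alpha> * b * x r) (M r))"
      by (intro prod.cong refl)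
    have args: "(\<lambda>r\<in>{1..n}. \<alpha> * a r) = (\<lambda>r\<in>{1..n}. \<alpha> * q ^ (1 + M r))"
      by (intro restrict_ext) (simp only: a plus_1_eq_Suc)
    show ?thesis
      unfolding identity_lhs_def rat args outer_diag_def F_def
      unfolding prod_dividef by (simp only: divide_inverse mult_ac)
  qed
  finally have "(\<Sum>k\<in>idx_box n M. identity_term n q \<alpha> b x f a k) = identity_lhs n q \<alpha> b x f a" .
  moreover have "identity_term n q \<alpha> b x f a k = 0" if "k \<in> multi_indices n - idx_box n M" for k
  proof -
    have "k \<in> extensional {1..n}"
      using that by (auto simp: multi_indices_def PiE_def)
    then have "\<exists>r\<in>{1..n}. M r < k r"
      using that unfolding Diff_iff mem_idx_box_iff not_le[symmetric] by blast
    then show ?thesis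
      unfolding * using outer_coeff_eq_0 by auto
  qed
  moreover have "idx_box n M \<subseteq> multi_indices n"
    unfolding multi_indices_def by (intro PiE_mono) simp
  ultimately show ?thesis
    using has_sum_finite_neutralI[OF finite_idx_box] by metis
qed

section \<open>Analytic continuation\<close>

text \<open>Around c(r := z0), moving only the r-th coordinate kills every monomial that involves
  another variable, so the multiple power series becomes an ordinary one.\<close>

lemma mv_analytic_on_slice:
  assumes F: "mv_analytic_on n F U" and r: "r \<in> {1..n}" and U: "\<And>z. z \<in> S \<Longrightarrow> c(r := z) \<in> U"
  shows "(\<lambda>z. F (c(r := z))) holomorphic_on S"
proof -
  have "\<exists>e>0. (\<lambda>z. F (c(r := z))) holomorphic_on ball z0 e" if z0: "z0 \<in> S" for z0
  proof -
    have "\<exists>\<rho>>0. \<exists>C. \<forall>z. (\<forall>s\<in>{1..n}. norm (z s - (c(r := z0)) s) < \<rho>) \<longrightarrow>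
        ((\<lambda>k. C k * (\<Prod>s=1..n. (z s - (c(r := z0)) s) ^ k s)) has_sum F z) (multi_indices n)"
      using F[unfolded mv_analytic_on_def] U[OF z0] by (rule bspec)
    then obtain \<rho> C where "\<rho> > 0" and C: "\<And>z. (\<forall>s\<in>{1..n}. norm (z s - (c(r := z0)) s) < \<rho>) \<Longrightarrow>
        ((\<lambda>k. C k * (\<Prod>s=1..n. (z s - (c(r := z0)) s) ^ k s)) has_sum F z) (multi_indices n)"
      by blast
    \<comment> \<open>These are the exponents of the pure powers of the r-th variable, the only
      terms of the series that survive.\<close>
    define h where "h j = (\<lambda>s\<in>{1..n}. if s = r then j else 0 :: nat)" for j
    have h_r: "h j r = j" for j
      using r by (simp add: h_def)
    have "inj h"
      using h_r by (metis injI)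
    have h_range: "k \<in> range h" if k: "k \<in> multi_indices n" "\<And>s. s \<in> {1..n} \<Longrightarrow> s \<noteq> r \<Longrightarrow> k s = 0" for k
    proof -
      have "k = h (k r)"
        using k unfolding h_def multi_indices_def
        by (intro extensionalityI[of _ "{1..n}"]) (auto simp: PiE_def)
      then show ?thesis by blast
    qed
    have "(\<lambda>j. C (h j) * (w - z0) ^ j) sums F (c(r := w))" if w: "w \<in> ball z0 \<rho>" for w
    proof -
      define t where "t k = C k * (\<Prod>s=1..n. ((c(r := w)) s - (c(r := z0)) s) ^ k s)" for k
      have "(t has_sum F (c(r := w))) (multi_indices n)"
        unfolding t_def using w \<open>\<rho> > 0\<close> by (intro C) (auto simp: dist_norm norm_minus_commute)
      moreover have "t k = 0" if k: "k \<in> multi_indices n - range h" for k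
      proof -
        obtain s where "s \<in> {1..n}" "s \<noteq> r" "k s \<noteq> 0"
          using k h_range[of k] by blast
        then show ?thesis
          unfolding t_def by (auto intro!: bexI[of _ s])
      qed
      moreover have "range h \<subseteq> multi_indices n"
        by (auto simp: h_def multi_indices_def)
      ultimately have "(t has_sum F (c(r := w))) (range h)"
        by (subst has_sum_cong_neutral[where S = "range h" and T = "multi_indices n" and g = t]) blast+
      then have "((t \<circ> h) has_sum F (c(r := w))) UNIV"
        using has_sum_reindex[OF \<open>inj h\<close>] by blast
      moreover have "t (h j) = C (h j) * (w - z0) ^ j" for j
      proof -
        have "(\<Prod>s=1..n. ((c(r := w)) s - (c(r := z0)) s) ^ h j s) = (w - z0) ^ j * (\<Prod>s\<in>{1..n}-{r}. 1)"
          using r by (subst prod.remove[of _ r]) (auto simp: h_def intro!: prod.cong)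
        then show ?thesis
          by (simp add: t_def)
      qed
      ultimately show ?thesis
        using has_sum_imp_sums[of "t \<circ> h"] by (simp add: o_def)
    qed
    then have "(\<lambda>z. F (c(r := z))) holomorphic_on ball z0 \<rho>"
      by (rule power_series_holomorphic)
    then show ?thesis
      using \<open>\<rho> > 0\<close> by blast
  qed
  then show ?thesis
    by (intro analytic_imp_holomorphic) (simp add: analytic_on_def)
qed

lemma mv_analytic_on_polydisc_eqI:
  assumes F: "mv_analytic_on n F (polydisc n R)" and G: "mv_analytic_on n G (polydisc n R)"
    and W: "0 islimpt W"
    and eq: "\<And>c. c \<in> polydisc n R \<Longrightarrow> (\<And>r. r \<in> {1..n} \<Longrightarrow> c r \<in> W) \<Longrightarrow> F c = G c"
    and c: "c \<in> polydisc n R"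
  shows "F c = G c"
proof -
  \<comment> \<open>The first \<open>j\<close> coordinates are already free and the later ones are
    still confined to \<open>W\<close>; each step frees one more by the identity theorem in that
    variable.\<close>
  have "c \<in> polydisc n R \<Longrightarrow> (\<And>r. r \<in> {1..n} \<Longrightarrow> j < r \<Longrightarrow> c r \<in> W) \<Longrightarrow> F c = G c" for j c
  proof (induction j arbitrary: c)
    case 0
    then show ?case
      by (intro eq) auto
  next
    case (Suc j)
    show ?case
    proof (cases "Suc j \<in> {1..n}")
      case r: True
      let ?S = "ball 0 (R (Suc j))"
      have upd: "c(Suc j := z) \<in> polydisc n R" if "z \<in> ?S" for z
        using Suc.prems(1) that by (auto simp: polydisc_def)
      have cS: "c (Suc j) \<in> ?S"
        using Suc.prems(1) r by (auto simp: polydisc_def)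
      then have R: "0 \<in> ?S"
        by (auto intro: le_less_trans[OF norm_ge_zero])
      have hol: "(\<lambda>z. F (c(Suc j := z)) - G (c(Suc j := z))) holomorphic_on ?S"
        by (intro holomorphic_on_diff mv_analytic_on_slice[OF F r] mv_analytic_on_slice[OF G r] upd)
      have zero: "F (c(Suc j := z)) - G (c(Suc j := z)) = 0" if "z \<in> W \<inter> ?S" for z
        using that Suc.prems(2) by (subst Suc.IH) (auto intro!: upd)
      have "0 islimpt (W \<inter> ?S)"
        using W R by (intro islimpt_Int_eventually eventually_at_in_open') auto
      from analytic_continuation[OF hol _ _ _ R this zero cS] show ?thesis
        by simp
    next
      case False
      then show ?thesis
        using Suc by auto
    qed
  qed
  from this[of c n] c show ?thesis
    by auto
qed

theorem theorem1p8:
  fixes n :: nat and q \<alpha> b :: complex and x a :: "nat \<Rightarrow> complex"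
    and f :: "(nat \<Rightarrow> complex) \<Rightarrow> complex"
  assumes "0 < norm q" and "norm q < 1" and "n \<ge> 1"
    and "denominators_nonzero n q \<alpha> b x a"
    and "(\<exists>R. a \<in> polydisc n R \<and>
            mv_analytic_on n (\<lambda>a'. identity_lhs n q \<alpha> b x f a') (polydisc n R) \<and>
            mv_analytic_on n (\<lambda>a'. \<Sum>\<^sub>\<infinity>k\<in>multi_indices n. identity_term n q \<alpha> b x f a' k)
              (polydisc n R) \<and>
            (\<forall>a'\<in>polydisc n R.
               (\<lambda>k. norm (identity_term n q \<alpha> b x f a' k)) summable_on multi_indices n))
       \<or> (\<exists>N :: nat \<Rightarrow> nat. \<forall>r\<in>{1..n}. N r > 0 \<and> a r = q ^ N r)"
  shows "((\<lambda>k. identity_term n q \<alpha> b x f a k) has_sum identity_lhs n q \<alpha> b x f a)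
           (multi_indices n)"
  using assms(5)
proof
  assume "\<exists>N :: nat \<Rightarrow> nat. \<forall>r\<in>{1..n}. N r > 0 \<and> a r = q ^ N r"
  then show ?thesis
    using terminating_identity[OF assms(1-4)] by blast
next
  assume "\<exists>R. a \<in> polydisc n R \<and>
            mv_analytic_on n (\<lambda>a'. identity_lhs n q \<alpha> b x f a') (polydisc n R) \<and>
            mv_analytic_on n (\<lambda>a'. \<Sum>\<^sub>\<infinity>k\<in>multi_indices n. identity_term n q \<alpha> b x f a' k)
              (polydisc n R) \<and>
            (\<forall>a'\<in>polydisc n R.
               (\<lambda>k. norm (identity_term n q \<alpha> b x f a' k)) summable_on multi_indices n)"
  then obtain R where a: "a \<in> polydisc n R"
    and an: "mv_analytic_on n (\<lambda>a'. identity_lhs n q \<alpha> b x f a') (polydisc n R)"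
      "mv_analytic_on n (\<lambda>a'. \<Sum>\<^sub>\<infinity>k\<in>multi_indices n. identity_term n q \<alpha> b x f a' k) (polydisc n R)"
    and summable: "(\<lambda>k. norm (identity_term n q \<alpha> b x f a k)) summable_on multi_indices n"
    by blast
  have q0: "(\<lambda>N. q ^ N) \<longlonglongrightarrow> 0"
    using assms(2) by (rule LIMSEQ_power_zero)
  have "eventually (\<lambda>N. norm (\<alpha> * x r * q ^ N) < 1) sequentially" for r
  proof -
    have "(\<lambda>N. norm (\<alpha> * x r * q ^ N)) \<longlonglongrightarrow> 0"
      by (intro tendsto_norm_zero tendsto_mult_right_zero q0)
    then show ?thesis
      by (rule order_tendstoD) simp
  qed
  then have "eventually (\<lambda>N. \<forall>r\<in>{1..n}. norm (\<alpha> * x r * q ^ N) < 1) sequentially"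
    by (intro eventually_ball_finite) auto
  then obtain N0 where N0: "\<And>N r. N \<ge> N0 \<Longrightarrow> r \<in> {1..n} \<Longrightarrow> norm (\<alpha> * x r * q ^ N) < 1"
    unfolding eventually_sequentially by blast
  \<comment> \<open>For \<open>N > N0\<close> no factor of \<open>(\<alpha> x\<^sub>r q\<^sup>N)\<^sub>\<infinity>\<close> vanishes, so the terminating case applies at these points.\<close>
  define W where "W = (\<lambda>N. q ^ N) ` {Suc N0..}"
  have "0 islimpt W"
    unfolding islimpt_sequential
  proof (intro exI[of _ "\<lambda>N. q ^ (N + Suc N0)"] conjI allI)
    show "q ^ (N + Suc N0) \<in> W - {0}" for N
      using assms(1) by (auto simp: W_def simp del: add_Suc_right)
    show "(\<lambda>N. q ^ (N + Suc N0)) \<longlonglongrightarrow> 0"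
      by (intro LIMSEQ_ignore_initial_segment q0)
  qed
  then have "identity_lhs n q \<alpha> b x f a = (\<Sum>\<^sub>\<infinity>k\<in>multi_indices n. identity_term n q \<alpha> b x f a k)"
  proof (rule mv_analytic_on_polydisc_eqI[OF an _ _ a])
    fix c assume c: "\<And>r. r \<in> {1..n} \<Longrightarrow> c r \<in> W"
    then have "\<forall>r\<in>{1..n}. \<exists>N. N \<ge> Suc N0 \<and> c r = q ^ N"
      unfolding W_def by blast
    then have "\<exists>N. \<forall>r\<in>{1..n}. N r \<ge> Suc N0 \<and> c r = q ^ N r"
      by (rule bchoice)
    then obtain N where N: "\<And>r. r \<in> {1..n} \<Longrightarrow> N r \<ge> Suc N0 \<and> c r = q ^ N r"
      by blast
    have small: "norm (\<alpha> * x r * c r) < 1" if "r \<in> {1..n}" for r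
      using N[OF that] N0[of "N r" r] that by simp
    \<comment> \<open>Only the conditions containing alpha x_r c_r are new; the others do not depend
      on the point and are inherited from \<open>a\<close>.\<close>
    then have "denominators_nonzero n q \<alpha> b x c"
      using assms(4) qpoch_inf_nonzero[OF assms(2) small] qpoch_nonzero[OF assms(2) small]
      unfolding denominators_nonzero_def by blast
    moreover have "N r > 0 \<and> c r = q ^ N r" if "r \<in> {1..n}" for r
      using N[OF that] by auto
    ultimately show "identity_lhs n q \<alpha> b x f c = (\<Sum>\<^sub>\<infinity>k\<in>multi_indices n. identity_term n q \<alpha> b x f c k)"
      using terminating_identity[OF assms(1-3)] by (metis infsumI)
  qed
  \<comment> \<open>The continuation yields only an equation for the value of the infinite sum;
    absolute convergence at \<open>a\<close> turns it into actual convergence to that value.\<close>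
  moreover have "(\<lambda>k. identity_term n q \<alpha> b x f a k) summable_on multi_indices n"
    using summable by (rule abs_summable_summable)
  ultimately show ?thesis
    by (simp add: has_sum_infsum)
qed

end
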